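(* Let $\ell\in\{1,\dots,n\}$ and $a,b\in\mathbb C^*$ with $\frac ab\notin\{q^{-2-d_\ell-m}:m\in\mathbb N\}$, and let $T(e^{\varpi_\ell}Y_{\ell,a}Y_{0,b}^{-1})=\mathcal U_q(sl_{n+1}^{tor})\cdot v\subseteq V(e^{\Lambda_\ell}Y_{\ell,a})\otimes V(e^{-\Lambda_0}Y_{0,b}^{-1})$ with $v=v^+\otimes v^-$. If the vector $v$ is extremal for the horizontal quantum affine subalgebra, then $\frac ab=q^{-d_\ell}$ and $$\begin{cases} n\text{ is even and }\ell\in\{1,n\},\\ \text{or}\\ n=2r+1\text{ is odd and }\ell\in\{1,r+1,n\}.\end{cases}$$
   Context: Fix an integer $n\ge 2$. $I=\{0,\dots,n\}$ is identified with $\mathbb Z/(n+1)\mathbb Z$; $C=(C_{i,j})_{i,j\in I}$ is the Cartan matrix of type $A_n^{(1)}$ ($C_{i,i}=2$, $C_{i,i\pm1}=-1$, $C_{i,j}=0$ otherwise). $\mathbb N=\{0,1,2,\dots\}$. Fix $t\in\mathbb C$ such that $q=e^t$ is not a root of unity; $q^x=e^{tx}$; $[l]_q=\frac{q^l-q^{-l}}{q-q^{-1}}$, $[r]_q!=[r]_q\cdots[1]_q$. $\mathfrak h=\mathbb Qh_0\oplus\dots\oplus\mathbb Qh_n\oplus\mathbb Qd$; $\alpha_i,\Lambda_i\in\mathfrak h^*$ are given by $\alpha_i(h_j)=C_{j,i}$, $\alpha_i(d)=\delta_{0,i}$, $\Lambda_i(h_j)=\delta_{i,j}$, $\Lambda_i(d)=0$;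 $P=\{\lambda\in\mathfrak h^*:\lambda(h_i)\in\mathbb Z\ \forall i\}$; $\varpi_\ell=\Lambda_\ell-\Lambda_0$; $d_\ell=\min(\ell,n+1-\ell)$. $\mathcal U_q(sl_{n+1}^{tor})$ is the $\mathbb C$-algebra with generators $x_{i,r}^\pm$ ($i\in I,r\in\mathbb Z$), $k_h$ ($h\in\mathfrak h$), $h_{i,m}$ ($i\in I$, $m\in\mathbb Z\setminus\{0\}$). Put $x_i^\pm(z)=\sum_{r\in\mathbb Z}x_{i,r}^\pm z^r$, $\delta(z)=\sum_{s\in\mathbb Z}z^s$, $k_i^{\pm1}=k_{\pm h_i}$, $\phi_i^\pm(z)=\sum_{m\ge0}\phi^\pm_{i,\pm m}z^{\pm m}=k_i^{\pm1}\exp(\pm(q-q^{-1})\sum_{m\ge1}h_{i,\pm m}z^{\pm m})$. Relations: $k_hk_{h'}=k_{h+h'}$, $k_0=1$; the $k_h$ and all coefficients of all $\phi_i^\pm(z)$ commute; $k_hx_j^\pm(z)k_{-h}=q^{\pm\alpha_j(h)}x_j^\pm(z)$; $(w-q^{\pm C_{ij}}z)\phi_i^{\epsilon}(z)x_j^\pm(w)=(q^{\pm C_{ij}}w-z)x_j^\pm(w)\phi_i^{\epsilon}(z)$ for $\epsilon=+,-$; $[x_i^+(z),x_j^-(w)]=\frac{\delta_{i,j}}{q-q^{-1}}(\delta(\frac wz)\phi_i^+(w)-\delta(\frac zw)\phi_i^-(z))$; $(w-q^{\pm C_{ij}}z)x_i^\pm(z)x_j^\pm(w)=(q^{\pm C_{ij}}w-z)x_j^\pm(w)x_i^\pm(z)$;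 for $j=i\pm1$: $x_i^\pm(z_1)x_i^\pm(z_2)x_j^\pm(w)-(q+q^{-1})x_i^\pm(z_1)x_j^\pm(w)x_i^\pm(z_2)+x_j^\pm(w)x_i^\pm(z_1)x_i^\pm(z_2)+(z_1\leftrightarrow z_2)=0$; $[x_i^\pm(z),x_j^\pm(w)]=0$ for $i\ne j,j\pm1$. Let $\psi(z)=\frac{q-q^{-1}z}{1-z}$. $V(e^{\Lambda_\ell}Y_{\ell,a})$ is the simple module generated by a vector $v^+$ ($\ell$-highest weight vector) with $x_{i,r}^+v^+=0$ for all $i,r$, $k_hv^+=q^{\Lambda_\ell(h)}v^+$, $\phi_i^\pm(z)v^+=\psi(aqz)^{\delta_{i,\ell}}v^+$. $V(e^{-\Lambda_0}Y_{0,b}^{-1})$ is the simple module generated by a vector $v^-$ ($\ell$-lowest weight vector) with $x_{i,r}^-v^-=0$ for all $i,r$, $k_hv^-=q^{-\Lambda_0(h)}v^-$, $\phi_i^\pm(z)v^-=\psi(bqz)^{-\delta_{i,0}}v^-$. Rational functions are expanded at $z=0$ for $\phi_i^+$ and at $z=\infty$ for $\phi_i^-$. Drinfeld coproduct: $\Delta_D(x_i^+(z))=x_i^+(z)\otimes1+\phi_i^-(z)\otimes x_i^+(z)$, $\Delta_D(x_i^-(z))=x_i^-(z)\otimes\phi_i^+(z)+1\otimes x_i^-(z)$, $\Delta_D(\phi_i^\pm(z))=\phi_i^\pm(z)\otimes\phi_i^\pm(z)$, $\Delta_D(k_h)=k_h\otimes k_h$. Under the assumption on $a/b$ the tensor product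 is a $\mathcal U_q(sl_{n+1}^{tor})$-module via $\Delta_D$, where the infinite sums mean: $x_{i,m}^+$ (resp. $x_{i,m}^-$) acts on $v_1\otimes w_1$ by the value at $u=1$ of the rational function in $u$ with expansion at $u=0$ equal to $x_{i,m}^+v_1\otimes w_1+\sum_{r\ge0}u^{m+r}\phi^-_{i,-r}v_1\otimes x^+_{i,m+r}w_1$ (resp. $\sum_{r\ge0}u^{r}x^-_{i,m-r}v_1\otimes\phi^+_{i,r}w_1+u^mv_1\otimes x^-_{i,m}w_1$). This module is integrable. Extremality for the horizontal quantum affine subalgebra (generated by the $k_h$ and $x_i^\pm:=x_{i,0}^\pm$): a vector $w$ of weight $\lambda\in P$ (i.e. $k_hw=q^{\lambda(h)}w$) is $i$-extremal if $x_i^{\pm}w=0$ when $\pm\lambda(h_i)\ge0$; then $S_i(w)=\frac{(x_i^\mp)^{\pm\lambda(h_i)}}{[\pm\lambda(h_i)]_q!}w$ when $\pm\lambda(h_i)\ge0$. It is extremal if for all $l\ge0$ and $i,i_1,\dots,i_l\in I$, $S_{i_1}\circ\cdots\circ S_{i_l}(w)$ is (defined and) $i$-extremal. *)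

theory Defs
  imports
    Complex_Main
    "HOL-Library.Poly_Mapping"
    "HOL-Computational_Algebra.Formal_Power_Series"
    "HOL-Computational_Algebra.Polynomial_FPS"
begin

section \<open>Complex vector spaces and their algebraic tensor product\<close>

class complex_vec = ab_group_add +
  fixes cscale :: "complex \<Rightarrow> 'a \<Rightarrow> 'a"  (infixr "*\<^sub>\<complex>" 75)
  assumes cscale_add_right: "c *\<^sub>\<complex> (v + w) = c *\<^sub>\<complex> v + c *\<^sub>\<complex> w"
    and cscale_add_left: "(c + d) *\<^sub>\<complex> v = c *\<^sub>\<complex> v + d *\<^sub>\<complex> v"
    and cscale_cscale: "c *\<^sub>\<complex> (d *\<^sub>\<complex> v) = (c * d) *\<^sub>\<complex> v"
    and cscale_one: "1 *\<^sub>\<complex> v = v"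

global_interpretation cvec: vector_space "cscale :: complex \<Rightarrow> 'a \<Rightarrow> 'a::complex_vec"
  by standard (rule cscale_add_right cscale_add_left cscale_cscale cscale_one)+

definition fscale :: "complex \<Rightarrow> ('k \<Rightarrow>\<^sub>0 complex) \<Rightarrow> ('k \<Rightarrow>\<^sub>0 complex)" where
  "fscale c f = Poly_Mapping.map ((*) c) f"

lemma lookup_fscale: "Poly_Mapping.lookup (fscale c f) k = c * Poly_Mapping.lookup f k"
  by (simp add: fscale_def map.rep_eq when_def)

global_interpretation fvec: vector_space "fscale :: complex \<Rightarrow> ('k \<Rightarrow>\<^sub>0 complex) \<Rightarrow> _"
  by standard
    (auto intro!: poly_mapping_eqI simp: lookup_fscale lookup_add algebra_simps)

abbreviation fsingle :: "'k \<Rightarrow> ('k \<Rightarrow>\<^sub>0 complex)" where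
  "fsingle k \<equiv> Poly_Mapping.single k 1"

definition bilinear_relators :: "('a::complex_vec \<times> 'b::complex_vec \<Rightarrow>\<^sub>0 complex) set" where
  "bilinear_relators =
     {fsingle (v + v', w) - fsingle (v, w) - fsingle (v', w) | v v' w. True} \<union>
     {fsingle (v, w + w') - fsingle (v, w) - fsingle (v, w') | v w w'. True} \<union>
     {fsingle (c *\<^sub>\<complex> v, w) - fscale c (fsingle (v, w)) | c v w. True} \<union>
     {fsingle (v, c *\<^sub>\<complex> w) - fscale c (fsingle (v, w)) | c v w. True}"

definition tensor_eq ::
    "('a::complex_vec \<times> 'b::complex_vec \<Rightarrow>\<^sub>0 complex) \<Rightarrow> ('a \<times> 'b \<Rightarrow>\<^sub>0 complex) \<Rightarrow> bool" where
  "tensor_eq f g \<longleftrightarrow> f - g \<in> fvec.span bilinear_relators"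

lemma tensor_eq_trans: "tensor_eq f g \<Longrightarrow> tensor_eq g h \<Longrightarrow> tensor_eq f h"
  unfolding tensor_eq_def using fvec.span_add[of "f - g" _ "g - h"] by simp

lemma equivp_tensor_eq: "equivp tensor_eq"
proof (rule equivpI)
  show "reflp tensor_eq"
    by (simp add: reflp_def tensor_eq_def fvec.span_zero)
  show "symp tensor_eq"
    unfolding symp_def tensor_eq_def by (metis fvec.span_neg minus_diff_eq)
  show "transp tensor_eq"
    using tensor_eq_trans by (rule transpI)
qed

quotient_type (overloaded) ('a, 'b) tensor =
    "'a::complex_vec \<times> 'b::complex_vec \<Rightarrow>\<^sub>0 complex" / tensor_eq
  by (rule equivp_tensor_eq)

instantiation tensor :: (complex_vec, complex_vec) complex_vec
begin

lift_definition zero_tensor :: "('a, 'b) tensor" is 0 .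

lift_definition plus_tensor :: "('a, 'b) tensor \<Rightarrow> ('a, 'b) tensor \<Rightarrow> ('a, 'b) tensor" is "(+)"
  unfolding tensor_eq_def by (metis add_diff_add fvec.span_add)

lift_definition minus_tensor :: "('a, 'b) tensor \<Rightarrow> ('a, 'b) tensor \<Rightarrow> ('a, 'b) tensor" is "(-)"
proof -
  fix f f' g g' :: "'a \<times> 'b \<Rightarrow>\<^sub>0 complex"
  assume "tensor_eq f f'" "tensor_eq g g'"
  then have "(f - f') - (g - g') \<in> fvec.span bilinear_relators"
    unfolding tensor_eq_def by (rule fvec.span_diff)
  then show "tensor_eq (f - g) (f' - g')"
    by (simp add: tensor_eq_def algebra_simps)
qed

lift_definition uminus_tensor :: "('a, 'b) tensor \<Rightarrow> ('a, 'b) tensor" is uminus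
  unfolding tensor_eq_def by (metis fvec.span_neg minus_diff_minus)

lift_definition cscale_tensor :: "complex \<Rightarrow> ('a, 'b) tensor \<Rightarrow> ('a, 'b) tensor" is fscale
  unfolding tensor_eq_def by (metis fvec.scale_right_diff_distrib fvec.span_scale)

instance
proof
  fix x y z :: "('a, 'b) tensor" and c d :: complex
  have refl: "tensor_eq f f" for f :: "'a \<times> 'b \<Rightarrow>\<^sub>0 complex"
    by (simp add: tensor_eq_def fvec.span_zero)
  show "x + y + z = x + (y + z)" by transfer (simp add: refl add.assoc)
  show "x + y = y + x" by transfer (simp add: refl add.commute)
  show "0 + x = x" by transfer (simp add: refl)
  show "- x + x = 0" by transfer (simp add: refl)
  show "x - y = x + - y" by transfer (simp add: refl)
  show "c *\<^sub>\<complex> (x + y) = c *\<^sub>\<complex> x + c *\<^sub>\<complex> y"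
    by transfer (simp add: refl fvec.scale_right_distrib)
  show "(c + d) *\<^sub>\<complex> x = c *\<^sub>\<complex> x + d *\<^sub>\<complex> x"
    by transfer (simp add: refl fvec.scale_left_distrib)
  show "c *\<^sub>\<complex> (d *\<^sub>\<complex> x) = (c * d) *\<^sub>\<complex> x" by transfer (simp add: refl)
  show "1 *\<^sub>\<complex> x = x" by transfer (simp add: refl)
qed

end

lift_definition tens :: "'a::complex_vec \<Rightarrow> 'b::complex_vec \<Rightarrow> ('a, 'b) tensor"  (infixr "\<otimes>" 76)
  is "\<lambda>v w. fsingle (v, w)" .

lemma tens_add_left: "(v + v') \<otimes> w = v \<otimes> w + v' \<otimes> w"
  by transfer (unfold tensor_eq_def diff_diff_eq[symmetric],
    rule fvec.span_base, unfold bilinear_relators_def, blast)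

lemma tens_add_right: "v \<otimes> (w + w') = v \<otimes> w + v \<otimes> w'"
  by transfer (unfold tensor_eq_def diff_diff_eq[symmetric],
    rule fvec.span_base, unfold bilinear_relators_def, blast)

lemma tens_scale_left: "(c *\<^sub>\<complex> v) \<otimes> w = c *\<^sub>\<complex> (v \<otimes> w)"
  by transfer (unfold tensor_eq_def, rule fvec.span_base, unfold bilinear_relators_def, blast)

lemma tens_scale_right: "v \<otimes> (c *\<^sub>\<complex> w) = c *\<^sub>\<complex> (v \<otimes> w)"
  by transfer (unfold tensor_eq_def, rule fvec.span_base, unfold bilinear_relators_def, blast)


section \<open>Root data of type \<open>A\<^sub>n\<^sup>(\<^sup>1\<^sup>)\<close>\<close>

definition adjacent :: "nat \<Rightarrow> nat \<Rightarrow> nat \<Rightarrow> bool" where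
  "adjacent n i j \<longleftrightarrow> (i + 1) mod (n + 1) = j \<or> (j + 1) mod (n + 1) = i"

definition cartan_matrix :: "nat \<Rightarrow> nat \<Rightarrow> nat \<Rightarrow> int" where
  "cartan_matrix n i j = (if i = j then 2 else if adjacent n i j then -1 else 0)"

text \<open>\<open>Co i\<close> indexes the basis vector \<open>h\<^sub>i\<close> and \<open>Deg\<close> the basis vector \<open>d\<close> of the Cartan
  subalgebra, whose elements are finitely supported rational coordinate vectors.\<close>

datatype cartan_index = Co nat | Deg

type_synonym cartan = "cartan_index \<Rightarrow>\<^sub>0 rat"

definition cartan_algebra :: "nat \<Rightarrow> cartan set" where
  "cartan_algebra n = {h. Poly_Mapping.keys h \<subseteq> insert Deg (Co ` {0..n})}"

definition coroot :: "nat \<Rightarrow> cartan" where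
  "coroot i = Poly_Mapping.single (Co i) 1"

text \<open>A weight is given by its values on the basis \<open>h\<^sub>0, \<dots>, h\<^sub>n, d\<close>; its values at indices \<open>Co i\<close>
  with \<open>i > n\<close> are irrelevant.\<close>

type_synonym weight = "cartan_index \<Rightarrow> rat"

definition pairing :: "weight \<Rightarrow> cartan \<Rightarrow> rat" where
  "pairing \<mu> h = (\<Sum>k\<in>Poly_Mapping.keys h. Poly_Mapping.lookup h k * \<mu> k)"

definition weight_lattice :: "nat \<Rightarrow> weight set" where
  "weight_lattice n = {\<mu>. \<forall>i\<le>n. pairing \<mu> (coroot i) \<in> \<int>}"

definition simple_root :: "nat \<Rightarrow> nat \<Rightarrow> weight" where
  "simple_root n i k =
     (case k of Co j \<Rightarrow> of_int (cartan_matrix n j i) | Deg \<Rightarrow> if i = 0 then 1 else 0)"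

definition fund_weight :: "nat \<Rightarrow> weight" where
  "fund_weight i k = (case k of Co j \<Rightarrow> if i = j then 1 else 0 | Deg \<Rightarrow> 0)"


section \<open>The quantum toroidal algebra\<close>

definition qpow :: "complex \<Rightarrow> rat \<Rightarrow> complex" where
  "qpow t x = exp (t * of_rat x)"

definition qint :: "complex \<Rightarrow> nat \<Rightarrow> complex" where
  "qint t l = (exp t ^ l - inverse (exp t) ^ l) / (exp t - inverse (exp t))"

definition qfact :: "complex \<Rightarrow> nat \<Rightarrow> complex" where
  "qfact t r = (\<Prod>l=1..r. qint t l)"

datatype pm = Pos | Neg

primrec sg :: "pm \<Rightarrow> int" where
  "sg Pos = 1"
| "sg Neg = -1"

primrec opp :: "pm \<Rightarrow> pm" where
  "opp Pos = Neg"
| "opp Neg = Pos"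

text \<open>\<open>GX \<epsilon> i r\<close>, \<open>GK h\<close> and \<open>GH i m\<close> stand for \<open>x\<^sup>\<epsilon>\<^bsub>i,r\<^esub>\<close>, \<open>k\<^sub>h\<close> and \<open>h\<^bsub>i,m\<^esub>\<close>.\<close>

datatype generator = GX pm nat int | GK cartan | GH nat int

definition generators :: "nat \<Rightarrow> generator set" where
  "generators n = {GX \<epsilon> i r | \<epsilon> i r. i \<le> n} \<union> {GK h | h. h \<in> cartan_algebra n} \<union>
     {GH i m | i m. i \<le> n \<and> m \<noteq> 0}"

datatype 'g word = Word (letters: "'g list")

instantiation word :: (type) monoid_add
begin

definition zero_word :: "'a word" where "zero_word = Word []"

definition plus_word :: "'a word \<Rightarrow> 'a word \<Rightarrow> 'a word" where
  "plus_word u v = Word (letters u @ letters v)"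

instance by standard (simp_all add: zero_word_def plus_word_def)

end

text \<open>Words form a free monoid, so the convolution product of \<^type>\<open>poly_mapping\<close> makes this type
  the free associative unital algebra. The toroidal algebra is the quotient of the subalgebra
  \<open>free_algebra n\<close> by the two-sided ideal generated by the differences \<open>r - s\<close> with
  \<open>tor_rel n t r s\<close>.\<close>

type_synonym free_alg = "generator word \<Rightarrow>\<^sub>0 complex"

definition free_algebra :: "nat \<Rightarrow> free_alg set" where
  "free_algebra n = {u. \<forall>w\<in>Poly_Mapping.keys u. set (letters w) \<subseteq> generators n}"

definition sc :: "complex \<Rightarrow> free_alg" where
  "sc c = Poly_Mapping.single 0 c"

definition gx :: "pm \<Rightarrow> nat \<Rightarrow> int \<Rightarrow> free_alg" where
  "gx \<epsilon> i r = Poly_Mapping.single (Word [GX \<epsilon> i r]) 1"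

definition gk :: "cartan \<Rightarrow> free_alg" where
  "gk h = Poly_Mapping.single (Word [GK h]) 1"

definition gh :: "nat \<Rightarrow> int \<Rightarrow> free_alg" where
  "gh i m = Poly_Mapping.single (Word [GH i m]) 1"

definition h_series :: "complex \<Rightarrow> pm \<Rightarrow> nat \<Rightarrow> free_alg fps" where
  "h_series t \<eta> i = Abs_fps (\<lambda>m. if m = 0 then 0
     else sc (of_int (sg \<eta>) * (exp t - inverse (exp t))) * gh i (sg \<eta> * int m))"

text \<open>The exponential of a power series without constant term; only the powers \<open>A^N\<close> with
  \<open>N \<le> m\<close> contribute to the coefficient of degree \<open>m\<close>.\<close>

definition exp_coeff :: "free_alg fps \<Rightarrow> nat \<Rightarrow> free_alg" where
  "exp_coeff A m = (\<Sum>N\<le>m. sc (1 / fact N) * fps_nth (A ^ N) m)"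

text \<open>\<open>phi t \<eta> i m\<close> is the coefficient of \<open>z^m\<close> in \<open>\<phi>\<^sub>i\<^sup>\<eta>(z)\<close>; it vanishes for \<open>m < 0\<close> if
  \<open>\<eta> = Pos\<close> and for \<open>m > 0\<close> if \<open>\<eta> = Neg\<close>.\<close>

definition phi :: "complex \<Rightarrow> pm \<Rightarrow> nat \<Rightarrow> int \<Rightarrow> free_alg" where
  "phi t \<eta> i m = (if sg \<eta> * m < 0 then 0
     else gk (case \<eta> of Pos \<Rightarrow> coroot i | Neg \<Rightarrow> - coroot i) *
       exp_coeff (h_series t \<eta> i) (nat (sg \<eta> * m)))"

text \<open>The relations between currents are written out as identities between the coefficients of
  \<open>z^r w^s\<close> (of \<open>z\<^sub>1^r z\<^sub>2^r' w^s\<close> for the Serre relation \<open>serre\<close>). In \<open>x_bracket\<close>, this coefficient is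
  \<open>\<phi>\<^sup>+\<^bsub>i,r+s\<^esub>\<close> in \<open>\<delta>(w/z) \<phi>\<^sub>i\<^sup>+(w)\<close> and \<open>\<phi>\<^sup>-\<^bsub>i,r+s\<^esub>\<close> in \<open>\<delta>(z/w) \<phi>\<^sub>i\<^sup>-(z)\<close>.\<close>

inductive tor_rel :: "nat \<Rightarrow> complex \<Rightarrow> free_alg \<Rightarrow> free_alg \<Rightarrow> bool" for n t where
  k_add: "h \<in> cartan_algebra n \<Longrightarrow> h' \<in> cartan_algebra n \<Longrightarrow>
     tor_rel n t (gk h * gk h') (gk (h + h'))"
| k_zero: "tor_rel n t (gk 0) 1"
| k_k_comm: "h \<in> cartan_algebra n \<Longrightarrow> h' \<in> cartan_algebra n \<Longrightarrow>
     tor_rel n t (gk h * gk h') (gk h' * gk h)"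
| k_phi_comm: "h \<in> cartan_algebra n \<Longrightarrow> i \<le> n \<Longrightarrow>
     tor_rel n t (gk h * phi t \<eta> i m) (phi t \<eta> i m * gk h)"
| phi_phi_comm: "i \<le> n \<Longrightarrow> j \<le> n \<Longrightarrow>
     tor_rel n t (phi t \<eta> i m * phi t \<eta>' j m') (phi t \<eta>' j m' * phi t \<eta> i m)"
| k_x: "h \<in> cartan_algebra n \<Longrightarrow> j \<le> n \<Longrightarrow>
     tor_rel n t (gk h * gx \<epsilon> j r * gk (- h))
       (sc (qpow t (of_int (sg \<epsilon>) * pairing (simple_root n j) h)) * gx \<epsilon> j r)"
| phi_x: "i \<le> n \<Longrightarrow> j \<le> n \<Longrightarrow> c = qpow t (of_int (sg \<epsilon> * cartan_matrix n i j)) \<Longrightarrow>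
     tor_rel n t
       (phi t \<eta> i r * gx \<epsilon> j (s - 1) - sc c * phi t \<eta> i (r - 1) * gx \<epsilon> j s)
       (sc c * gx \<epsilon> j (s - 1) * phi t \<eta> i r - gx \<epsilon> j s * phi t \<eta> i (r - 1))"
| x_bracket: "i \<le> n \<Longrightarrow> j \<le> n \<Longrightarrow>
     tor_rel n t
       (gx Pos i r * gx Neg j s - gx Neg j s * gx Pos i r)
       (if i = j then sc (1 / (exp t - inverse (exp t))) *
          (phi t Pos i (r + s) - phi t Neg i (r + s)) else 0)"
| x_x: "i \<le> n \<Longrightarrow> j \<le> n \<Longrightarrow> c = qpow t (of_int (sg \<epsilon> * cartan_matrix n i j)) \<Longrightarrow>
     tor_rel n t
       (gx \<epsilon> i r * gx \<epsilon> j (s - 1) - sc c * gx \<epsilon> i (r - 1) * gx \<epsilon> j s)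
       (sc c * gx \<epsilon> j (s - 1) * gx \<epsilon> i r - gx \<epsilon> j s * gx \<epsilon> i (r - 1))"
| serre: "i \<le> n \<Longrightarrow> j \<le> n \<Longrightarrow> adjacent n i j \<Longrightarrow>
     c = sc (exp t + inverse (exp t)) \<Longrightarrow>
     tor_rel n t
       (  gx \<epsilon> i r * gx \<epsilon> i r' * gx \<epsilon> j s - c * gx \<epsilon> i r * gx \<epsilon> j s * gx \<epsilon> i r'
          + gx \<epsilon> j s * gx \<epsilon> i r * gx \<epsilon> i r'
        + gx \<epsilon> i r' * gx \<epsilon> i r * gx \<epsilon> j s - c * gx \<epsilon> i r' * gx \<epsilon> j s * gx \<epsilon> i r
          + gx \<epsilon> j s * gx \<epsilon> i r' * gx \<epsilon> i r)
       0"
| x_x_comm: "i \<le> n \<Longrightarrow> j \<le> n \<Longrightarrow> i \<noteq> j \<Longrightarrow> \<not> adjacent n i j \<Longrightarrow>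
     tor_rel n t (gx \<epsilon> i r * gx \<epsilon> j s) (gx \<epsilon> j s * gx \<epsilon> i r)"


section \<open>Modules\<close>

text \<open>A module over the toroidal algebra is a module over \<open>free_algebra n\<close> on which the defining
  relations hold. Here and below, nothing is said about \<open>act u\<close> for \<open>u \<notin> free_algebra n\<close>.\<close>

definition tor_module :: "nat \<Rightarrow> complex \<Rightarrow> (free_alg \<Rightarrow> 'v \<Rightarrow> 'v::complex_vec) \<Rightarrow> bool" where
  "tor_module n t act \<longleftrightarrow>
     (\<forall>u\<in>free_algebra n. \<forall>v w. act u (v + w) = act u v + act u w) \<and>
     (\<forall>u\<in>free_algebra n. \<forall>c v. act u (c *\<^sub>\<complex> v) = c *\<^sub>\<complex> act u v) \<and>
     (\<forall>u\<in>free_algebra n. \<forall>u'\<in>free_algebra n. \<forall>v. act (u + u') v = act u v + act u' v) \<and>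
     (\<forall>c. \<forall>u\<in>free_algebra n. \<forall>v. act (sc c * u) v = c *\<^sub>\<complex> act u v) \<and>
     (\<forall>v. act 1 v = v) \<and>
     (\<forall>u\<in>free_algebra n. \<forall>u'\<in>free_algebra n. \<forall>v. act (u * u') v = act u (act u' v)) \<and>
     (\<forall>r s. tor_rel n t r s \<longrightarrow> (\<forall>v. act r v = act s v))"

definition submodule :: "nat \<Rightarrow> (free_alg \<Rightarrow> 'v \<Rightarrow> 'v::complex_vec) \<Rightarrow> 'v set \<Rightarrow> bool" where
  "submodule n act W \<longleftrightarrow> cvec.subspace W \<and> (\<forall>u\<in>free_algebra n. \<forall>v\<in>W. act u v \<in> W)"

definition simple_module :: "nat \<Rightarrow> (free_alg \<Rightarrow> 'v \<Rightarrow> 'v::complex_vec) \<Rightarrow> bool" where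
  "simple_module n act \<longleftrightarrow>
     (\<exists>v::'v. v \<noteq> 0) \<and> (\<forall>W. submodule n act W \<longrightarrow> W = {0} \<or> W = UNIV)"

definition generated_submodule :: "nat \<Rightarrow> (free_alg \<Rightarrow> 'v \<Rightarrow> 'v) \<Rightarrow> 'v \<Rightarrow> 'v set" where
  "generated_submodule n act v = {act u v | u. u \<in> free_algebra n}"

text \<open>\<open>psi_expansion t \<eta> c\<close> is the expansion of \<open>\<psi>(cz) = (q - q\<^sup>-\<^sup>1 cz) / (1 - cz)\<close>, in powers of
  \<open>z\<close> at \<open>z = 0\<close> if \<open>\<eta> = Pos\<close> and in powers of \<open>z\<^sup>-\<^sup>1\<close> at \<open>z = \<infinity>\<close> if \<open>\<eta> = Neg\<close>. For \<open>c \<noteq> 0\<close>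
  numerator and denominator both have degree 1, so the latter is the expansion at 0 of the
  quotient of the reflected polynomials.\<close>

definition psi_num :: "complex \<Rightarrow> complex \<Rightarrow> complex poly" where
  "psi_num t c = [:exp t, - (inverse (exp t) * c):]"

definition psi_den :: "complex \<Rightarrow> complex poly" where
  "psi_den c = [:1, - c:]"

primrec psi_expansion :: "complex \<Rightarrow> pm \<Rightarrow> complex \<Rightarrow> complex fps" where
  "psi_expansion t Pos c = fps_of_poly (psi_num t c) / fps_of_poly (psi_den c)"
| "psi_expansion t Neg c =
     fps_of_poly (reflect_poly (psi_num t c)) / fps_of_poly (reflect_poly (psi_den c))"

definition weight_vector ::
    "nat \<Rightarrow> complex \<Rightarrow> (free_alg \<Rightarrow> 'v \<Rightarrow> 'v::complex_vec) \<Rightarrow> weight \<Rightarrow> 'v \<Rightarrow> bool" where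
  "weight_vector n t act \<mu> w \<longleftrightarrow>
     (\<forall>h\<in>cartan_algebra n. act (gk h) w = qpow t (pairing \<mu> h) *\<^sub>\<complex> w)"

text \<open>\<open>act\<close> is (a realization of) \<open>V(e\<^bsup>\<Lambda>\<^esup> Y\<^bsub>l,a\<^esub>)\<close>, with \<open>\<Lambda> = \<Lambda>\<^sub>l\<close> and
  \<open>l\<close>-highest weight vector \<open>v\<close>.\<close>

definition is_V_highest :: "nat \<Rightarrow> complex \<Rightarrow> nat \<Rightarrow> complex \<Rightarrow>
    (free_alg \<Rightarrow> 'v \<Rightarrow> 'v::complex_vec) \<Rightarrow> 'v \<Rightarrow> bool" where
  "is_V_highest n t l a act v \<longleftrightarrow>
     tor_module n t act \<and> simple_module n act \<and> generated_submodule n act v = UNIV \<and>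
     (\<forall>i\<le>n. \<forall>r. act (gx Pos i r) v = 0) \<and>
     weight_vector n t act (fund_weight l) v \<and>
     (\<forall>i\<le>n. \<forall>\<eta>. \<forall>m::nat. act (phi t \<eta> i (sg \<eta> * int m)) v =
        fps_nth (if i = l then psi_expansion t \<eta> (a * exp t) else 1) m *\<^sub>\<complex> v)"

text \<open>\<open>act\<close> is (a realization of) \<open>V(e\<^bsup>-\<Lambda>\<^esup> Y\<^bsub>0,b\<^esub>\<^sup>-\<^sup>1)\<close>, with \<open>\<Lambda> = \<Lambda>\<^sub>0\<close> and
  lowest weight vector \<open>v\<close>.\<close>

definition is_V_lowest :: "nat \<Rightarrow> complex \<Rightarrow> complex \<Rightarrow>
    (free_alg \<Rightarrow> 'v \<Rightarrow> 'v::complex_vec) \<Rightarrow> 'v \<Rightarrow> bool" where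
  "is_V_lowest n t b act v \<longleftrightarrow>
     tor_module n t act \<and> simple_module n act \<and> generated_submodule n act v = UNIV \<and>
     (\<forall>i\<le>n. \<forall>r. act (gx Neg i r) v = 0) \<and>
     weight_vector n t act (\<lambda>k. - fund_weight 0 k) v \<and>
     (\<forall>i\<le>n. \<forall>\<eta>. \<forall>m::nat. act (phi t \<eta> i (sg \<eta> * int m)) v =
        fps_nth (if i = 0 then inverse (psi_expansion t \<eta> (b * exp t)) else 1) m *\<^sub>\<complex> v)"


section \<open>The Drinfeld coproduct\<close>

text \<open>The Laurent series \<open>\<Sum>\<^sub>k F(k) u\<^sup>k\<close> is the expansion at \<open>u = 0\<close> of a vector-valued rational
  function \<open>N(u) / D(u)\<close>, with \<open>N\<close> a Laurent polynomial, that is regular at \<open>u = 1\<close> and has the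
  value \<open>y\<close> there.\<close>

definition rational_value_at_1 :: "(int \<Rightarrow> 'v::complex_vec) \<Rightarrow> 'v \<Rightarrow> bool" where
  "rational_value_at_1 F y \<longleftrightarrow>
     (\<exists>k0. \<forall>k<k0. F k = 0) \<and>
     (\<exists>(D :: complex poly) (N :: int \<Rightarrow>\<^sub>0 'v).
        poly D 1 \<noteq> 0 \<and>
        (\<forall>k. (\<Sum>j\<le>degree D. coeff D j *\<^sub>\<complex> F (k - int j)) = Poly_Mapping.lookup N k) \<and>
        poly D 1 *\<^sub>\<complex> y = (\<Sum>k\<in>Poly_Mapping.keys N. Poly_Mapping.lookup N k))"

text \<open>The Laurent series in \<open>u\<close> regularizing the actions of \<open>\<Delta>\<^sub>D(x\<^sup>+\<^bsub>i,m\<^esub>)\<close> and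
  \<open>\<Delta>\<^sub>D(x\<^sup>-\<^bsub>i,m\<^esub>)\<close> on \<open>v \<otimes> w\<close>. In the first one, the coefficient of \<open>u\<^sup>k\<close> comes from the summand
  \<open>r = k - m\<close>.\<close>

definition coproduct_x_pos_series :: "complex \<Rightarrow>
    (free_alg \<Rightarrow> 'v \<Rightarrow> 'v::complex_vec) \<Rightarrow> (free_alg \<Rightarrow> 'w \<Rightarrow> 'w::complex_vec) \<Rightarrow>
    nat \<Rightarrow> int \<Rightarrow> 'v \<Rightarrow> 'w \<Rightarrow> int \<Rightarrow> ('v, 'w) tensor" where
  "coproduct_x_pos_series t act1 act2 i m v w k =
     (if k = 0 then act1 (gx Pos i m) v \<otimes> w else 0) +
     (if k \<ge> m then act1 (phi t Neg i (- (k - m))) v \<otimes> act2 (gx Pos i k) w else 0)"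

definition coproduct_x_neg_series :: "complex \<Rightarrow>
    (free_alg \<Rightarrow> 'v \<Rightarrow> 'v::complex_vec) \<Rightarrow> (free_alg \<Rightarrow> 'w \<Rightarrow> 'w::complex_vec) \<Rightarrow>
    nat \<Rightarrow> int \<Rightarrow> 'v \<Rightarrow> 'w \<Rightarrow> int \<Rightarrow> ('v, 'w) tensor" where
  "coproduct_x_neg_series t act1 act2 i m v w k =
     (if k \<ge> 0 then act1 (gx Neg i (m - k)) v \<otimes> act2 (phi t Pos i k) w else 0) +
     (if k = m then v \<otimes> act2 (gx Neg i m) w else 0)"

text \<open>\<open>act\<close> is the module structure on the tensor product given by \<open>\<Delta>\<^sub>D\<close>. It is uniquely
  determined, since the action of the \<open>h\<^bsub>i,m\<^esub>\<close> is recovered from that of the \<open>\<phi>\<^sub>i\<^sup>\<plusminus>(z)\<close>.\<close>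

definition is_drinfeld_tensor :: "nat \<Rightarrow> complex \<Rightarrow>
    (free_alg \<Rightarrow> 'v \<Rightarrow> 'v::complex_vec) \<Rightarrow> (free_alg \<Rightarrow> 'w \<Rightarrow> 'w::complex_vec) \<Rightarrow>
    (free_alg \<Rightarrow> ('v, 'w) tensor \<Rightarrow> ('v, 'w) tensor) \<Rightarrow> bool" where
  "is_drinfeld_tensor n t act1 act2 act \<longleftrightarrow>
     tor_module n t act \<and>
     (\<forall>h\<in>cartan_algebra n. \<forall>v w. act (gk h) (v \<otimes> w) = act1 (gk h) v \<otimes> act2 (gk h) w) \<and>
     (\<forall>i\<le>n. \<forall>\<eta>. \<forall>m::nat. \<forall>v w. act (phi t \<eta> i (sg \<eta> * int m)) (v \<otimes> w) =
        (\<Sum>r\<le>m. act1 (phi t \<eta> i (sg \<eta> * int r)) v \<otimes> act2 (phi t \<eta> i (sg \<eta> * int (m - r))) w)) \<and>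
     (\<forall>i\<le>n. \<forall>m. \<forall>v w. rational_value_at_1
        (coproduct_x_pos_series t act1 act2 i m v w) (act (gx Pos i m) (v \<otimes> w))) \<and>
     (\<forall>i\<le>n. \<forall>m. \<forall>v w. rational_value_at_1
        (coproduct_x_neg_series t act1 act2 i m v w) (act (gx Neg i m) (v \<otimes> w)))"


section \<open>Extremal vectors for the horizontal subalgebra\<close>

definition i_extremal_of_weight ::
    "nat \<Rightarrow> complex \<Rightarrow> (free_alg \<Rightarrow> 'v \<Rightarrow> 'v::complex_vec) \<Rightarrow> nat \<Rightarrow> weight \<Rightarrow> 'v \<Rightarrow> bool" where
  "i_extremal_of_weight n t act i \<mu> w \<longleftrightarrow>
     \<mu> \<in> weight_lattice n \<and> weight_vector n t act \<mu> w \<and>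
     (\<forall>\<epsilon>. of_int (sg \<epsilon>) * pairing \<mu> (coroot i) \<ge> 0 \<longrightarrow> act (gx \<epsilon> i 0) w = 0)"

definition i_extremal ::
    "nat \<Rightarrow> complex \<Rightarrow> (free_alg \<Rightarrow> 'v \<Rightarrow> 'v::complex_vec) \<Rightarrow> nat \<Rightarrow> 'v \<Rightarrow> bool" where
  "i_extremal n t act i w \<longleftrightarrow> (\<exists>\<mu>. i_extremal_of_weight n t act i \<mu> w)"

text \<open>The graph of the partial operator \<open>S\<^sub>i\<close>: \<open>w\<close> is \<open>i\<close>-extremal and \<open>w' = S\<^sub>i(w)\<close>.\<close>

definition S_graph :: "nat \<Rightarrow> complex \<Rightarrow> (free_alg \<Rightarrow> 'v \<Rightarrow> 'v::complex_vec) \<Rightarrow>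
    nat \<Rightarrow> 'v \<Rightarrow> 'v \<Rightarrow> bool" where
  "S_graph n t act i w w' \<longleftrightarrow>
     (\<exists>\<mu> \<epsilon> r. i_extremal_of_weight n t act i \<mu> w \<and>
        of_int (sg \<epsilon>) * pairing \<mu> (coroot i) = of_nat r \<and>
        w' = (1 / qfact t r) *\<^sub>\<complex> act (gx (opp \<epsilon>) i 0 ^ r) w)"

text \<open>\<open>S_composite n t act [i\<^sub>1, \<dots>, i\<^sub>l] w w'\<close>: the vector
  \<open>(S\<^bsub>i\<^sub>1\<^esub> \<circ> \<dots> \<circ> S\<^bsub>i\<^sub>l\<^esub>)(w)\<close> is defined and equals \<open>w'\<close>.\<close>

fun S_composite :: "nat \<Rightarrow> complex \<Rightarrow> (free_alg \<Rightarrow> 'v \<Rightarrow> 'v::complex_vec) \<Rightarrow>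
    nat list \<Rightarrow> 'v \<Rightarrow> 'v \<Rightarrow> bool" where
  "S_composite n t act [] w w' \<longleftrightarrow> w' = w"
| "S_composite n t act (i # is) w w' \<longleftrightarrow>
     (\<exists>u. S_composite n t act is w u \<and> S_graph n t act i u w')"

text \<open>\<open>w\<close> is an extremal vector of the submodule \<open>W\<close>.\<close>

definition extremal :: "nat \<Rightarrow> complex \<Rightarrow> (free_alg \<Rightarrow> 'v \<Rightarrow> 'v::complex_vec) \<Rightarrow>
    'v set \<Rightarrow> 'v \<Rightarrow> bool" where
  "extremal n t act W w \<longleftrightarrow> w \<in> W \<and>
     (\<forall>is. set is \<subseteq> {0..n} \<longrightarrow>
        (\<exists>w'\<in>W. S_composite n t act is w w' \<and> (\<forall>i\<le>n. i_extremal n t act i w')))"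

end

theory Submission
  imports Defs
begin

text \<open>
  Lower the \<open>\<ell>\<close>-highest weight vector \<open>v\<^sup>+\<close> successively by \<open>x\<^sup>-\<^bsub>c 0,0\<^esub>, x\<^sup>-\<^bsub>c 1,0\<^esub>, \<dots>\<close>, where
  \<open>c 0 = \<ell>, c 1, c 2, \<dots>\<close> is an induced path in the cyclic Dynkin diagram: two of these colours are
  adjacent exactly if they are consecutive. Only the colour \<open>c k\<close> can lower the resulting vector
  \<open>u\<^sub>k\<close> further among the colours \<open>c k, c (k + 1), \<dots>\<close> still ahead, and its \<open>\<phi>\<close>-eigenvalue on \<open>u\<^sub>k\<close> is
  \<open>\<psi>(\<gamma>\<^sub>k z)\<close> with \<open>\<gamma>\<^sub>k = a q\<^bsup>k+1\<^esup>\<close>: each step along the path multiplies the spectral parameter by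
  \<open>q\<close>. Moreover \<open>x\<^sup>-\<^bsub>c k,r\<^esub> u\<^sub>k = \<gamma>\<^sub>k\<^sup>r u\<^bsub>k+1\<^esub>\<close>. The invariant carried along the
  path is \<open>path_state\<close>; the last formula follows from it (\<open>lower_path\<close>).

  Let the path reach colour \<open>0\<close> after \<open>L\<close> steps. Before that no colour is visible to the second
  tensor factor, so the operators \<open>S\<^bsub>c k\<^esub>\<close> just carry \<open>v\<^sup>+ \<otimes> v\<^sup>-\<close> to \<open>u\<^sub>L \<otimes> v\<^sup>-\<close>
  (\<open>S_composite_path\<close>). There the weight at \<open>h\<^sub>0\<close> is \<open>1 - 1 = 0\<close>, so extremality demands
  \<open>x\<^sup>-\<^bsub>0,0\<^esub>(u\<^sub>L \<otimes> v\<^sup>-) = 0\<close>. By the coproduct this vector is the value at \<open>u = 1\<close> of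
  \<open>\<psi>(b q u / \<gamma>\<^sub>L)\<^sup>-\<^sup>1 u\<^bsub>L+1\<^esub> \<otimes> v\<^sup>-\<close>, and \<open>u\<^bsub>L+1\<^esub> \<otimes> v\<^sup>-\<close> is nonzero. Hence the numerator
  \<open>1 - b q / \<gamma>\<^sub>L\<close> vanishes, which says \<open>a q\<^sup>L = b\<close> (\<open>extremal_imp_ratio\<close>).

  The two arcs of the cycle from \<open>\<ell>\<close> to \<open>0\<close> have lengths \<open>\<ell>\<close> and \<open>n + 1 - \<ell>\<close>. The first one is an
  induced path if \<open>\<ell> < n\<close> and the second one if \<open>\<ell> > 1\<close>. For \<open>\<ell> \<in> {1, n}\<close> the arc of length
  \<open>1 = d\<^sub>\<ell>\<close> is available and gives the ratio. For \<open>1 < \<ell> < n\<close> both are available, so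
  \<open>q\<^sup>\<ell> = q\<^bsup>n+1-\<ell>\<^esup>\<close>, and as \<open>q\<close> is not a root of unity, \<open>\<ell>\<close> is the midpoint of the cycle.

  The simple modules are given only by generators and simplicity, without a basis. That a vector in
  them vanishes is deduced from \<open>singular_vector_eq_0\<close>: a vector below the top height that is killed by all
  raising operators is zero, because the lowering operators span a proper submodule from it.
\<close>

section \<open>The free algebra\<close>

lemma free_algebra_add [simp]:
  "u \<in> free_algebra n \<Longrightarrow> u' \<in> free_algebra n \<Longrightarrow> u + u' \<in> free_algebra n"
  unfolding free_algebra_def using Poly_Mapping.keys_add by fastforce

lemma free_algebra_diff [simp]:
  "u \<in> free_algebra n \<Longrightarrow> u' \<in> free_algebra n \<Longrightarrow> u - u' \<in> free_algebra n"
  unfolding free_algebra_def using keys_diff by fastforce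

lemma free_algebra_mult [simp]:
  assumes "u \<in> free_algebra n" "u' \<in> free_algebra n"
  shows "u * u' \<in> free_algebra n"
  using assms keys_mult[of u u'] unfolding free_algebra_def
  by (fastforce simp: plus_word_def)

lemma free_algebra_single: "set (letters w) \<subseteq> generators n \<Longrightarrow> Poly_Mapping.single w c \<in> free_algebra n"
  by (simp add: free_algebra_def)

lemma free_algebra_sc [simp]: "sc c \<in> free_algebra n"
  unfolding sc_def by (rule free_algebra_single) (simp add: zero_word_def)

lemma sc_0: "sc 0 = 0" and sc_1: "sc 1 = 1"
  by (simp_all add: sc_def)

lemma free_algebra_0 [simp]: "0 \<in> free_algebra n" and free_algebra_1 [simp]: "1 \<in> free_algebra n"
  using free_algebra_sc[of 0] free_algebra_sc[of 1] by (simp_all only: sc_0 sc_1)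

lemma free_algebra_gx [simp]: "i \<le> n \<Longrightarrow> gx \<epsilon> i r \<in> free_algebra n"
  unfolding gx_def by (rule free_algebra_single) (auto simp: generators_def)

lemma free_algebra_gk [simp]: "h \<in> cartan_algebra n \<Longrightarrow> gk h \<in> free_algebra n"
  unfolding gk_def by (rule free_algebra_single) (auto simp: generators_def)

lemma free_algebra_gh: "i \<le> n \<Longrightarrow> m \<noteq> 0 \<Longrightarrow> gh i m \<in> free_algebra n"
  unfolding gh_def by (rule free_algebra_single) (auto simp: generators_def)

lemma coroot_in_cartan [simp]: "i \<le> n \<Longrightarrow> coroot i \<in> cartan_algebra n"
  by (simp add: coroot_def cartan_algebra_def)

lemma uminus_in_cartan [simp]: "h \<in> cartan_algebra n \<Longrightarrow> - h \<in> cartan_algebra n"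
  by (simp add: cartan_algebra_def)

lemma single_scalar_word: "Poly_Mapping.single w c = sc c * Poly_Mapping.single w 1"
  by (simp add: sc_def mult_single)

lemma single_word_Cons:
  "Poly_Mapping.single (Word (g # gs)) (1::complex) =
     Poly_Mapping.single (Word [g]) 1 * Poly_Mapping.single (Word gs) 1"
  by (simp add: mult_single plus_word_def)

lemma free_algebra_induct [consumes 1, case_names sc add mult letter]:
  assumes "u \<in> free_algebra n"
    and sc: "\<And>c. P (sc c)"
    and add: "\<And>u u'. P u \<Longrightarrow> P u' \<Longrightarrow> P (u + u')"
    and mult: "\<And>u u'. P u \<Longrightarrow> P u' \<Longrightarrow> P (u * u')"
    and letter: "\<And>g. g \<in> generators n \<Longrightarrow> P (Poly_Mapping.single (Word [g]) 1)"
  shows "P u"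
proof -
  have word: "P (Poly_Mapping.single (Word gs) 1)" if "set gs \<subseteq> generators n" for gs
    using that
  proof (induction gs)
    case Nil
    then show ?case using sc[of 1] by (simp add: sc_def zero_word_def)
  next
    case (Cons g gs)
    then show ?case using mult letter by (subst single_word_Cons) simp
  qed
  have scaled: "P (Poly_Mapping.single w c)" if "set (letters w) \<subseteq> generators n" for w c
    using mult[OF sc[of c] word[OF that]] by (cases w) (simp add: single_scalar_word[symmetric])
  show ?thesis
    using assms(1)
  proof (induction u rule: update_induct)
    case const
    then show ?case using sc[of 0] by (simp add: sc_0)
  next
    case (update f w c)
    have eq: "Poly_Mapping.update w c f = f + Poly_Mapping.single w c"
      using update by (intro poly_mapping_eqI) (auto simp: lookup_update lookup_add lookup_single in_keys_iff)
    have "Poly_Mapping.keys (Poly_Mapping.update w c f) = insert w (Poly_Mapping.keys f)"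
      using update by (simp add: keys_update)
    then show ?case
      using update add scaled by (auto simp: free_algebra_def eq)
  qed
qed


section \<open>Recovering the Heisenberg generators from the Cartan currents\<close>

lemma sum_closed:
  assumes "0 \<in> S" "\<And>x y. x \<in> S \<Longrightarrow> y \<in> S \<Longrightarrow> x + y \<in> S" "\<And>i. i \<in> I \<Longrightarrow> f i \<in> S"
  shows "sum f I \<in> S"
  using assms(3) by (induction I rule: infinite_finite_induct) (auto intro: assms)

lemma fps_power_nth_closed:
  fixes A :: "'a::ring_1 fps"
  assumes S: "0 \<in> S" "1 \<in> S" "\<And>x y. x \<in> S \<Longrightarrow> y \<in> S \<Longrightarrow> x + y \<in> S"
      "\<And>x y. x \<in> S \<Longrightarrow> y \<in> S \<Longrightarrow> x * y \<in> S"
    and A: "\<And>j. j < m \<Longrightarrow> fps_nth A j \<in> S"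
  shows "j < m \<Longrightarrow> fps_nth (A ^ N) j \<in> S"
proof (induction N arbitrary: j)
  case 0
  then show ?case using S by (cases j) auto
next
  case (Suc N)
  then show ?case
    by (auto simp: fps_mult_nth intro!: sum_closed[where S = S] S A)
qed

text \<open>In a power \<open>A\<^sup>N\<close> with \<open>N \<ge> 2\<close> the top coefficient \<open>A\<^sub>m\<close> would be multiplied by a power of
  the constant term, which is \<open>0\<close>; so only smaller coefficients occur in degree \<open>m\<close>.\<close>

lemma fps_power_nth_closed_ge_2:
  fixes A :: "'a::ring_1 fps"
  assumes S: "0 \<in> S" "1 \<in> S" "\<And>x y. x \<in> S \<Longrightarrow> y \<in> S \<Longrightarrow> x + y \<in> S"
      "\<And>x y. x \<in> S \<Longrightarrow> y \<in> S \<Longrightarrow> x * y \<in> S"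
    and A: "\<And>j. j < m \<Longrightarrow> fps_nth A j \<in> S"
    and A0: "fps_nth A 0 = 0" and N: "N \<ge> 2"
  shows "fps_nth (A ^ N) m \<in> S"
proof -
  obtain M where M: "N = Suc (Suc M)"
    using N by (metis add_2_eq_Suc le_Suc_ex)
  have summand: "fps_nth A i * fps_nth (A ^ Suc M) (m - i) \<in> S" if "i \<le> m" for i
  proof (cases "i = 0 \<or> i = m")
    case True
    then show ?thesis using S(1) A0 by (auto simp: fps_mult_nth)
  next
    case False
    then show ?thesis
      using that S(4)[OF A[of i] fps_power_nth_closed[OF S A, where j = "m - i" and N = "Suc M"]] by auto
  qed
  then show ?thesis
    unfolding M power_Suc[of A "Suc M"] fps_mult_nth[of A "A ^ Suc M"]
    by (intro sum_closed[where S = S] S(1,3) summand) auto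
qed

lemma exp_coeff_closed:
  assumes S: "\<And>c. sc c \<in> S" "\<And>x y. x \<in> S \<Longrightarrow> y \<in> S \<Longrightarrow> x + y \<in> S"
      "\<And>x y. x \<in> S \<Longrightarrow> y \<in> S \<Longrightarrow> x * y \<in> S"
    and A: "\<And>j. j \<le> m \<Longrightarrow> fps_nth A j \<in> S"
  shows "exp_coeff A m \<in> S"
proof -
  have S01: "0 \<in> S" "1 \<in> S"
    using S(1)[of 0] S(1)[of 1] by (simp_all add: sc_0 sc_1)
  show ?thesis
    unfolding exp_coeff_def
    by (intro sum_closed[where S = S] S S01 fps_power_nth_closed[where m = "Suc m"])
      (auto intro: A)
qed

lemma nth_eq_exp_coeff_minus:
  assumes "m \<ge> 1"
  shows "fps_nth A m = exp_coeff A m - (\<Sum>N=2..m. sc (1 / fact N) * fps_nth (A ^ N) m)"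
proof -
  have "{..m} = insert 0 (insert 1 {2..m})" using assms by auto
  then have "exp_coeff A m = sc 1 * fps_nth (A ^ 0) m + (sc 1 * fps_nth (A ^ 1) m +
      (\<Sum>N=2..m. sc (1 / fact N) * fps_nth (A ^ N) m))"
    unfolding exp_coeff_def by simp
  then show ?thesis using assms by (simp add: sc_1)
qed

text \<open>The exponential is triangular: in degree \<open>m\<close> it is \<open>A\<close> plus products of
  coefficients of \<open>A\<close> of smaller degree.\<close>

lemma nth_closed_if_exp_coeff_closed:
  assumes S: "\<And>c. sc c \<in> S" "\<And>x y. x \<in> S \<Longrightarrow> y \<in> S \<Longrightarrow> x + y \<in> S"
      "\<And>x y. x \<in> S \<Longrightarrow> y \<in> S \<Longrightarrow> x * y \<in> S"
    and A0: "fps_nth A 0 = 0" and E: "\<And>m. exp_coeff A m \<in> S"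
  shows "fps_nth A m \<in> S"
proof (induction m rule: less_induct)
  case (less m)
  have S01: "0 \<in> S" "1 \<in> S"
    using S(1)[of 0] S(1)[of 1] by (simp_all add: sc_0 sc_1)
  show ?case
  proof (cases "m = 0")
    case True
    then show ?thesis using A0 S01 by simp
  next
    case False
    have "(\<Sum>N=2..m. sc (1 / fact N) * fps_nth (A ^ N) m) \<in> S"
      by (intro sum_closed[where S = S] S S01 fps_power_nth_closed_ge_2[OF S01 S(2,3)] less.IH A0)
        auto
    moreover have "sc (-1) * x = - x" for x
      by (metis minus_mult_left mult_1 sc_1 sc_def single_uminus)
    ultimately show ?thesis
      using False S(2)[OF E[of m] S(3)[OF S(1)[of "-1"]]]
      by (subst nth_eq_exp_coeff_minus) auto
  qed
qed

lemma h_series_nth_0 [simp]: "fps_nth (h_series t \<eta> i) 0 = 0"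
  by (simp add: h_series_def)

lemma free_algebra_h_series: "i \<le> n \<Longrightarrow> fps_nth (h_series t \<eta> i) m \<in> free_algebra n"
  by (cases \<eta>) (auto simp: h_series_def intro!: free_algebra_mult free_algebra_gh)

lemma free_algebra_exp_h_series [simp]:
  "i \<le> n \<Longrightarrow> exp_coeff (h_series t \<eta> i) m \<in> free_algebra n"
  by (intro exp_coeff_closed) (auto intro: free_algebra_h_series)

lemma free_algebra_phi [simp]: "i \<le> n \<Longrightarrow> phi t \<eta> i m \<in> free_algebra n"
  by (cases \<eta>) (auto simp: phi_def)

lemma phi_wrong_sign [simp]: "sg \<eta> * m < 0 \<Longrightarrow> phi t \<eta> i m = 0"
  by (simp add: phi_def)

lemma phi_Pos_0: "phi t Pos i 0 = gk (coroot i)"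
  by (simp add: phi_def exp_coeff_def sc_1)


section \<open>Modules over the quantum toroidal algebra\<close>

text \<open>A statement about all modes of \<open>\<phi>\<^sub>i\<^sup>\<eta>(z)\<close> is proved by moving from one mode to a
  neighbouring one, starting from \<open>- sg \<eta>\<close>, where the mode is \<open>0\<close>.\<close>

lemma mode_induct:
  fixes P :: "int \<Rightarrow> bool"
  assumes "P m" and step: "\<And>r. P (r - 1) \<longleftrightarrow> P r"
  shows "P r"
proof (induction r rule: int_induct[where k = m])
  case (step1 i)
  then show ?case using step[of "i + 1"] by simp
qed (use assms in auto)

text \<open>That \<open>q\<close> is not a root of unity makes \<open>q - q\<^sup>-\<^sup>1\<close> invertible and separates the heights.\<close>

locale toroidal_module =
  fixes n :: nat and t :: complex and act :: "free_alg \<Rightarrow> 'v::complex_vec \<Rightarrow> 'v"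
  assumes tor_module: "tor_module n t act"
    and q_not_root_of_unity: "m > 0 \<Longrightarrow> exp t ^ m \<noteq> 1"
begin

abbreviation X where "X \<epsilon> i r \<equiv> act (gx \<epsilon> i r)"
abbreviation \<Phi> where "\<Phi> \<eta> i m \<equiv> act (phi t \<eta> i m)"
abbreviation K where "K h \<equiv> act (gk h)"

lemma q_minus_inverse_nonzero: "exp t - inverse (exp t) \<noteq> 0"
proof
  assume "exp t - inverse (exp t) = 0"
  then have "exp t * exp t = 1" by (simp add: field_simps)
  then show False using q_not_root_of_unity[of 2] by (simp add: power2_eq_square)
qed

lemma act_vec_add: "u \<in> free_algebra n \<Longrightarrow> act u (v + w) = act u v + act u w"
  and act_vec_scale: "u \<in> free_algebra n \<Longrightarrow> act u (c *\<^sub>\<complex> v) = c *\<^sub>\<complex> act u v"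
  and act_add: "u \<in> free_algebra n \<Longrightarrow> u' \<in> free_algebra n \<Longrightarrow> act (u + u') v = act u v + act u' v"
  and act_sc_mult: "u \<in> free_algebra n \<Longrightarrow> act (sc c * u) v = c *\<^sub>\<complex> act u v"
  and act_1: "act 1 v = v"
  and act_mult: "u \<in> free_algebra n \<Longrightarrow> u' \<in> free_algebra n \<Longrightarrow> act (u * u') v = act u (act u' v)"
  and act_rel: "tor_rel n t r s \<Longrightarrow> act r v = act s v"
  using tor_module unfolding tor_module_def by blast+

lemma act_sc: "act (sc c) v = c *\<^sub>\<complex> v"
  using act_sc_mult[of 1 c v] by (simp add: act_1)

lemma act_0: "act 0 v = 0"
  using act_sc[of 0 v] by (simp add: sc_0)

lemma act_diff:
  "u \<in> free_algebra n \<Longrightarrow> u' \<in> free_algebra n \<Longrightarrow> act (u - u') v = act u v - act u' v"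
  using act_add[of "u - u'" u' v] by (simp add: algebra_simps)

lemma act_vec_0: "u \<in> free_algebra n \<Longrightarrow> act u 0 = 0"
  using act_vec_scale[of u 0 0] by simp

lemma act_vec_diff: "u \<in> free_algebra n \<Longrightarrow> act u (v - w) = act u v - act u w"
  using act_vec_add[of u "v - w" w] by (simp add: algebra_simps)

lemmas act_simps = act_vec_add act_vec_diff act_vec_scale act_vec_0 act_add act_diff act_sc_mult
  act_1 act_mult act_sc act_0

lemma \<Phi>_wrong_sign [simp]: "\<Phi> \<eta> i (- sg \<eta>) v = 0"
  by (cases \<eta>) (simp_all add: act_0)

lemma \<Phi>_X:
  assumes "i \<le> n" "j \<le> n"
  shows "\<Phi> \<eta> i r (X \<epsilon> j (s - 1) v) - qpow t (of_int (sg \<epsilon> * cartan_matrix n i j)) *\<^sub>\<complex> \<Phi> \<eta> i (r - 1) (X \<epsilon> j s v)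
     = qpow t (of_int (sg \<epsilon> * cartan_matrix n i j)) *\<^sub>\<complex> X \<epsilon> j (s - 1) (\<Phi> \<eta> i r v) - X \<epsilon> j s (\<Phi> \<eta> i (r - 1) v)"
  using act_rel[OF phi_x[OF assms refl, where \<epsilon> = \<epsilon> and r = r and s = s and t = t and \<eta> = \<eta>], of v] assms
  by (simp add: act_simps mult.assoc)

lemma X_bracket:
  assumes "i \<le> n" "j \<le> n"
  shows "X Pos i r (X Neg j s v) = X Neg j s (X Pos i r v) +
    (if i = j then (1 / (exp t - inverse (exp t))) *\<^sub>\<complex> (\<Phi> Pos i (r + s) v - \<Phi> Neg i (r + s) v) else 0)"
  using act_rel[OF x_bracket[OF assms, where r = r and s = s and t = t], of v] assms
  by (auto simp: act_simps mult.assoc algebra_simps split: if_splits)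

lemma K_minus_K: "h \<in> cartan_algebra n \<Longrightarrow> K (- h) (K h v) = v"
  using act_rel[OF k_add[of "- h" n h t], of v] act_rel[OF k_zero, of v]
  by (simp add: act_simps)

lemma K_X:
  assumes "h \<in> cartan_algebra n" "j \<le> n"
  shows "K h (X \<epsilon> j r v) =
    qpow t (of_int (sg \<epsilon>) * pairing (simple_root n j) h) *\<^sub>\<complex> X \<epsilon> j r (K h v)"
  using act_rel[OF k_x[OF assms, where r = r and t = t and \<epsilon> = \<epsilon>], of "K h v"] assms
  by (simp add: act_simps K_minus_K mult.assoc)

lemma K_K: "h \<in> cartan_algebra n \<Longrightarrow> h' \<in> cartan_algebra n \<Longrightarrow> K h (K h' v) = K h' (K h v)"
  using act_rel[OF k_k_comm[of h n h' t], of v] by (simp add: act_simps)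

lemma K_\<Phi>: "h \<in> cartan_algebra n \<Longrightarrow> i \<le> n \<Longrightarrow> K h (\<Phi> \<eta> i m v) = \<Phi> \<eta> i m (K h v)"
  using act_rel[OF k_phi_comm[of h n i t \<eta> m], of v] by (simp add: act_simps)

text \<open>The \<open>h\<^bsub>i,m\<^esub>\<close> are polynomials in the \<open>k\<^sub>h\<close> and the modes of the \<open>\<phi>\<^sub>i\<^sup>\<plusminus>(z)\<close>, as the exponential can be
  inverted degree by degree and \<open>q - q\<^sup>-\<^sup>1\<close> is nonzero. The latter elements are better suited for testing
  stability, because the relations are given in terms of them.\<close>

lemma submoduleI:
  assumes W: "cvec.subspace W"
    and X: "\<And>\<epsilon> i r v. i \<le> n \<Longrightarrow> v \<in> W \<Longrightarrow> X \<epsilon> i r v \<in> W"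
    and K: "\<And>h v. h \<in> cartan_algebra n \<Longrightarrow> v \<in> W \<Longrightarrow> K h v \<in> W"
    and \<Phi>: "\<And>\<eta> i m v. i \<le> n \<Longrightarrow> v \<in> W \<Longrightarrow> \<Phi> \<eta> i m v \<in> W"
  shows "submodule n act W"
proof -
  define S where "S = {u \<in> free_algebra n. \<forall>v\<in>W. act u v \<in> W}"
  have S: "sc c \<in> S" "x \<in> S \<Longrightarrow> y \<in> S \<Longrightarrow> x + y \<in> S" "x \<in> S \<Longrightarrow> y \<in> S \<Longrightarrow> x * y \<in> S" for c x y
    by (auto simp: S_def act_simps cvec.subspace_scale[OF W] cvec.subspace_add[OF W])
  have h_series: "fps_nth (h_series t \<eta> i) m \<in> S" if "i \<le> n" for \<eta> i m
  proof (rule nth_closed_if_exp_coeff_closed[OF S])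
    show "exp_coeff (h_series t \<eta> i) m \<in> S" for m
    proof -
      let ?h = "case \<eta> of Pos \<Rightarrow> coroot i | Neg \<Rightarrow> - coroot i"
      have h: "?h \<in> cartan_algebra n" using that by (cases \<eta>) auto
      have "\<not> sg \<eta> * (sg \<eta> * int m) < 0" "nat (sg \<eta> * (sg \<eta> * int m)) = m"
        by (cases \<eta>; simp)+
      then have "phi t \<eta> i (sg \<eta> * int m) = gk ?h * exp_coeff (h_series t \<eta> i) m"
        unfolding phi_def by simp
      then have "\<Phi> \<eta> i (sg \<eta> * int m) v = K ?h (act (exp_coeff (h_series t \<eta> i) m) v)" for v
        using that h by (simp add: act_simps)
      then have "act (exp_coeff (h_series t \<eta> i) m) v = K (- ?h) (\<Phi> \<eta> i (sg \<eta> * int m) v)" for v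
        using h by (simp add: K_minus_K)
      then show ?thesis
        using that h by (auto simp: S_def intro!: K \<Phi>)
    qed
  qed simp_all
  have gh: "gh i m \<in> S" if "i \<le> n" "m \<noteq> 0" for i m
  proof -
    define \<eta> where "\<eta> = (if m > 0 then Pos else Neg)"
    have "m = sg \<eta> * int (nat \<bar>m\<bar>)" "nat \<bar>m\<bar> \<noteq> 0"
      using that by (auto simp: \<eta>_def)
    then have "fps_nth (h_series t \<eta> i) (nat \<bar>m\<bar>) =
        sc (of_int (sg \<eta>) * (exp t - inverse (exp t))) * gh i m"
      by (simp add: h_series_def)
    moreover have "sc c * (sc d * u) = sc (c * d) * u" for c d u
      by (simp add: sc_def mult_single mult.assoc[symmetric])
    ultimately have "gh i m = sc (inverse (of_int (sg \<eta>) * (exp t - inverse (exp t)))) *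
        fps_nth (h_series t \<eta> i) (nat \<bar>m\<bar>)"
      using q_minus_inverse_nonzero by (cases \<eta>) (simp_all add: sc_1)
    then show ?thesis using h_series[OF that(1)] S by simp
  qed
  have "u \<in> S" if "u \<in> free_algebra n" for u
    using that
  proof (induction rule: free_algebra_induct)
    case (letter g)
    then consider (x) \<epsilon> i r where "g = GX \<epsilon> i r" "i \<le> n" | (k) h where "g = GK h" "h \<in> cartan_algebra n"
      | (h) i m where "g = GH i m" "i \<le> n" "m \<noteq> 0"
      by (auto simp: generators_def)
    then show ?case
    proof cases
      case x
      then have "gx \<epsilon> i r \<in> S" using X by (auto simp: S_def)
      then show ?thesis by (simp add: x gx_def)
    next
      case k
      then have "gk h \<in> S" using K by (auto simp: S_def)
      then show ?thesis by (simp add: k gk_def)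
    next
      case h
      then show ?thesis using gh by (simp add: gh_def)
    qed
  qed (rule S; assumption)+
  then show ?thesis using W by (auto simp: submodule_def S_def)
qed

end


section \<open>Singular vectors of simple modules\<close>

text \<open>A finite product of operators \<open>T - \<nu>\<close> kills every vector of the span while acting on \<open>v\<close> by
  the nonzero scalar given by the product of the \<open>\<mu> - \<nu>\<close>.\<close>

lemma eigenvector_in_span_eq_0:
  fixes T :: "'a::complex_vec \<Rightarrow> 'a"
  assumes T: "Vector_Spaces.linear cscale cscale T"
    and S: "\<And>s. s \<in> S \<Longrightarrow> \<exists>\<nu>. \<nu> \<noteq> \<mu> \<and> T s = \<nu> *\<^sub>\<complex> s"
    and v: "v \<in> cvec.span S" "T v = \<mu> *\<^sub>\<complex> v"
  shows "v = 0"
proof -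
  interpret T: Vector_Spaces.linear cscale cscale T by (rule T)
  define op where "op = foldr (\<lambda>c x. T x - c *\<^sub>\<complex> x)"
  have op_eigen: "op cs x = prod_list (map (\<lambda>c. \<nu> - c) cs) *\<^sub>\<complex> x" if "T x = \<nu> *\<^sub>\<complex> x" for cs x \<nu>
    by (induction cs) (simp_all add: op_def T.scale that cvec.scale_left_diff_distrib algebra_simps)
  have op_linear: "op cs (x + y) = op cs x + op cs y" "op cs (c *\<^sub>\<complex> x) = c *\<^sub>\<complex> op cs x" for cs x y c
    by (induction cs)
      (simp_all add: op_def T.add T.scale cvec.scale_right_distrib cvec.scale_right_diff_distrib algebra_simps)
  have op_zero: "op cs 0 = 0" for cs
    using op_linear(2)[of cs 0 0] by simp
  obtain S0 r where S0: "finite S0" "S0 \<subseteq> S" "v = (\<Sum>s\<in>S0. r s *\<^sub>\<complex> s)"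
    using v(1) unfolding cvec.span_explicit by blast
  obtain e where e: "e s \<noteq> \<mu>" "T s = e s *\<^sub>\<complex> s" if "s \<in> S" for s
    using S by metis
  obtain cs where cs: "set cs = e ` S0"
    using finite_list[of "e ` S0"] S0(1) by auto
  have kill: "op cs (r s *\<^sub>\<complex> s) = 0" if "s \<in> S0" for s
  proof -
    have "0 \<in> set (map (\<lambda>c. e s - c) cs)" using that cs by auto
    then have "prod_list (map (\<lambda>c. e s - c) cs) = 0" by (simp only: prod_list_zero_iff)
    then show ?thesis using that S0 e by (simp add: op_linear op_eigen[of s "e s"] subset_eq)
  qed
  have kill_sum: "op cs (\<Sum>s\<in>R. r s *\<^sub>\<complex> s) = 0" if "R \<subseteq> S0" for R
    using finite_subset[OF that S0(1)] that
    by (induction R rule: finite_induct) (simp_all add: op_zero op_linear(1) kill)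
  have "prod_list (map (\<lambda>c. \<mu> - c) cs) *\<^sub>\<complex> v = op cs v"
    by (rule op_eigen[OF v(2), symmetric])
  also have "\<dots> = 0"
    by (subst S0(3)) (rule kill_sum[OF subset_refl])
  finally have "prod_list (map (\<lambda>c. \<mu> - c) cs) *\<^sub>\<complex> v = 0" .
  moreover have "prod_list (map (\<lambda>c. \<mu> - c) cs) \<noteq> 0"
  proof -
    have "\<mu> \<notin> set cs"
      unfolding cs using e(1) S0(2) by (metis imageE subsetD)
    then show ?thesis unfolding prod_list_zero_iff by auto
  qed
  ultimately show ?thesis by simp
qed

lemma pairing_on_cartan:
  assumes "h \<in> cartan_algebra n"
  shows "pairing \<mu> h = (\<Sum>j\<le>n. Poly_Mapping.lookup h (Co j) * \<mu> (Co j)) + Poly_Mapping.lookup h Deg * \<mu> Deg"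
proof -
  have "pairing \<mu> h = (\<Sum>k\<in>insert Deg (Co ` {..n}). Poly_Mapping.lookup h k * \<mu> k)"
    unfolding pairing_def using assms
    by (intro sum.mono_neutral_left) (auto simp: cartan_algebra_def in_keys_iff atMost_atLeast0)
  also have "\<dots> = Poly_Mapping.lookup h Deg * \<mu> Deg + (\<Sum>k\<in>Co ` {..n}. Poly_Mapping.lookup h k * \<mu> k)"
    by (rule sum.insert) auto
  also have "(\<Sum>k\<in>Co ` {..n}. Poly_Mapping.lookup h k * \<mu> k) = (\<Sum>j\<le>n. Poly_Mapping.lookup h (Co j) * \<mu> (Co j))"
    by (subst sum.reindex) (auto simp: inj_on_def)
  finally show ?thesis by simp
qed

lemma adjacent_iff:
  assumes "i \<le> n" "j \<le> n"
  shows "adjacent n i j \<longleftrightarrow> j = i + 1 \<or> i = j + 1 \<or> (i = n \<and> j = 0) \<or> (j = n \<and> i = 0)"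
proof -
  have "(k + 1) mod (n + 1) = (if k = n then 0 else k + 1)" if "k \<le> n" for k
    using that by simp
  then show ?thesis
    using assms by (auto simp: adjacent_def)
qed

text \<open>An element of the Cartan subalgebra at which every simple root, including \<open>\<alpha>\<^sub>0\<close>, takes the
  value \<open>1\<close>: the half sum of positive coroots of type \<open>A\<^sub>n\<close> plus a multiple of \<open>d\<close>. It turns
  \<open>k\<^sub>\<rho>\<close> into a grading operator by height.\<close>

definition rho :: "nat \<Rightarrow> cartan" where
  "rho n = (\<Sum>j\<le>n. Poly_Mapping.single (Co j) (of_nat j * (of_nat n + 1 - of_nat j) / 2)) +
     Poly_Mapping.single Deg (of_nat n + 1)"

lemma lookup_rho:
  "Poly_Mapping.lookup (rho n) Deg = of_nat n + 1"
  "Poly_Mapping.lookup (rho n) (Co j) = (if j \<le> n then of_nat j * (of_nat n + 1 - of_nat j) / 2 else 0)"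
  by (simp_all add: rho_def lookup_add lookup_sum lookup_single when_def)

lemma rho_in_cartan [simp]: "rho n \<in> cartan_algebra n"
proof -
  have "k \<in> insert Deg (Co ` {0..n})" if "Poly_Mapping.lookup (rho n) k \<noteq> 0" for k
    using that by (cases k) (auto simp: lookup_rho split: if_splits)
  then show ?thesis by (auto simp: cartan_algebra_def in_keys_iff)
qed

lemma pairing_simple_root_rho:
  assumes "n \<ge> 2" "i \<le> n"
  shows "pairing (simple_root n i) (rho n) = 1"
proof -
  define c :: "nat \<Rightarrow> rat" where "c j = of_nat j * (of_nat n + 1 - of_nat j) / 2" for j
  have eq: "pairing (simple_root n i) (rho n) =
      (\<Sum>j\<le>n. c j * of_int (cartan_matrix n j i)) + (if i = 0 then of_nat n + 1 else 0)"
    by (simp add: pairing_on_cartan[OF rho_in_cartan] lookup_rho simple_root_def c_def)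
  show ?thesis
  proof (cases "i = 0")
    case True
    have "adjacent n j 0 \<longleftrightarrow> j = 1 \<or> j = n" if "j \<le> n" for j
      using that assms(1) by (auto simp: adjacent_iff)
    then have "c j * of_int (cartan_matrix n j i) =
        (if j = 1 then - c 1 else 0) + (if j = n then - c n else 0)" if "j \<le> n" for j
      using that True assms(1) by (auto simp: cartan_matrix_def c_def)
    then have "(\<Sum>j\<le>n. c j * of_int (cartan_matrix n j i)) =
        (\<Sum>j\<le>n. (if j = 1 then - c 1 else 0) + (if j = n then - c n else 0))"
      by (intro sum.cong) auto
    also have "\<dots> = - c 1 - c n"
      using assms(1) by (subst sum.distrib) simp
    also have "\<dots> = - of_nat n"
      by (simp add: c_def field_simps)
    finally show ?thesis unfolding eq using True by simp
  next
    case False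
    have "adjacent n j i \<longleftrightarrow> j + 1 = i \<or> j = i + 1 \<or> (i = n \<and> j = 0)" if "j \<le> n" for j
      using that assms False by (auto simp: adjacent_iff)
    then have "c j * of_int (cartan_matrix n j i) =
        (if j = i then 2 * c i else 0) + (if j = i - 1 then - c (i - 1) else 0)
          + (if j = i + 1 then - c (i + 1) else 0)" if "j \<le> n" for j
      using that False assms by (auto simp: cartan_matrix_def c_def)
    then have "(\<Sum>j\<le>n. c j * of_int (cartan_matrix n j i)) =
        (\<Sum>j\<le>n. ((if j = i then 2 * c i else 0) + (if j = i - 1 then - c (i - 1) else 0))
          + (if j = i + 1 then - c (i + 1) else 0))"
      by (intro sum.cong) auto
    also have "\<dots> = 2 * c i - c (i - 1) + (if i + 1 \<le> n then - c (i + 1) else 0)"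
      using assms False by (simp only: sum.distrib) (auto simp: sum.delta')
    also have "\<dots> = 2 * c i - c (i - 1) - c (i + 1)"
      using assms by (auto simp: c_def not_le le_Suc_eq)
    also have "\<dots> = 1"
      using False by (cases i) (simp_all add: c_def algebra_simps add_divide_distrib diff_divide_distrib)
    finally show ?thesis unfolding eq using False by simp
  qed
qed

lemma qpow_of_int: "qpow t (of_int k) = exp t powi k"
  by (simp add: qpow_def exp_power_int mult.commute)

lemma qpow_nonzero [simp]: "qpow t x \<noteq> 0"
  by (simp add: qpow_def)

context toroidal_module
begin

inductive_set lowering_orbit :: "'v set \<Rightarrow> 'v set" for E where
  base: "y \<in> E \<Longrightarrow> y \<in> lowering_orbit E"
| lower: "y \<in> lowering_orbit E \<Longrightarrow> j \<le> n \<Longrightarrow> X Neg j s y \<in> lowering_orbit E"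

lemma act_maps_span:
  assumes "u \<in> free_algebra n" "\<And>y. y \<in> B \<Longrightarrow> act u y \<in> cvec.span C" "y \<in> cvec.span B"
  shows "act u y \<in> cvec.span C"
  using assms(3)
proof (induction rule: cvec.span_induct)
  case (step x)
  then show ?case using assms(2) by simp
qed (auto intro!: cvec.subspaceI cvec.span_add cvec.span_scale cvec.span_zero simp: act_simps assms(1))

lemma lowering_span_stable:
  "j \<le> n \<Longrightarrow> y \<in> cvec.span (lowering_orbit E) \<Longrightarrow> X Neg j s y \<in> cvec.span (lowering_orbit E)"
  by (rule act_maps_span) (auto intro: cvec.span_base lower)

text \<open>If \<open>y\<close> is singular, the exchange relation between \<open>\<phi>\<^sub>i(z)\<close> and \<open>x\<^sup>+\<^sub>j(w)\<close> loses the terms in which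
  \<open>x\<^sup>+\<close> acts first. What remains ties \<open>x\<^sup>+\<^sub>j \<phi>\<^bsub>i,r\<^esub> y\<close> to \<open>x\<^sup>+\<^sub>j \<phi>\<^bsub>i,r-1\<^esub> y\<close>, so that vanishing spreads
  from the modes that are zero by definition.\<close>

lemma singular_\<Phi>:
  assumes "\<And>j r. j \<le> n \<Longrightarrow> X Pos j r y = 0" "i \<le> n" "j \<le> n"
  shows "X Pos j s (\<Phi> \<eta> i r y) = 0"
proof -
  have shift: "qpow t (of_int (cartan_matrix n i j)) *\<^sub>\<complex> X Pos j (s - 1) (\<Phi> \<eta> i r y) = X Pos j s (\<Phi> \<eta> i (r - 1) y)" for r s
    using \<Phi>_X[of i j \<eta> r Pos s y] assms by (simp add: act_vec_0)
  have "\<forall>s. X Pos j s (\<Phi> \<eta> i r y) = 0"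
  proof (rule mode_induct[where P = "\<lambda>r. \<forall>s. X Pos j s (\<Phi> \<eta> i r y) = 0"])
    show "\<forall>s. X Pos j s (\<Phi> \<eta> i (- sg \<eta>) y) = 0"
      using assms(3) by (simp add: act_vec_0)
    show "(\<forall>s. X Pos j s (\<Phi> \<eta> i (r - 1) y) = 0) \<longleftrightarrow> (\<forall>s. X Pos j s (\<Phi> \<eta> i r y) = 0)" for r
    proof
      assume "\<forall>s. X Pos j s (\<Phi> \<eta> i (r - 1) y) = 0"
      then have "qpow t (of_int (cartan_matrix n i j)) *\<^sub>\<complex> X Pos j s (\<Phi> \<eta> i r y) = 0" for s
        using shift[of "s + 1" r] by simp
      then show "\<forall>s. X Pos j s (\<Phi> \<eta> i r y) = 0" by simp
    next
      assume "\<forall>s. X Pos j s (\<Phi> \<eta> i r y) = 0"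
      then show "\<forall>s. X Pos j s (\<Phi> \<eta> i (r - 1) y) = 0"
        by (simp flip: shift)
    qed
  qed
  then show ?thesis by blast
qed

text \<open>The spanning half of the triangular decomposition. The Cartan currents are moved to the right
  past a lowering operator one mode at a time; a raising operator either reaches \<open>E\<close>, where it
  vanishes, or is turned into Cartan currents by the bracket relation.\<close>

lemma lowering_span_submodule:
  assumes singular: "\<And>y j r. y \<in> E \<Longrightarrow> j \<le> n \<Longrightarrow> X Pos j r y = 0"
    and E_K: "\<And>y h. y \<in> E \<Longrightarrow> h \<in> cartan_algebra n \<Longrightarrow> K h y \<in> E"
    and E_\<Phi>: "\<And>y \<eta> i r. y \<in> E \<Longrightarrow> i \<le> n \<Longrightarrow> \<Phi> \<eta> i r y \<in> E"
  shows "submodule n act (cvec.span (lowering_orbit E))" (is "submodule n act ?W")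
proof (rule submoduleI)
  have W_E: "y \<in> E \<Longrightarrow> y \<in> ?W" for y
    by (auto intro: cvec.span_base base)
  have orbit_K: "K h y \<in> ?W" if "y \<in> lowering_orbit E" "h \<in> cartan_algebra n" for h y
    using that(1)
  proof induction
    case (base y)
    then show ?case using W_E E_K that(2) by blast
  next
    case (lower y j s)
    then show ?case
      using lowering_span_stable by (simp add: K_X that(2) cvec.span_scale)
  qed
  have orbit_\<Phi>: "\<Phi> \<eta> i r y \<in> ?W" if "y \<in> lowering_orbit E" "i \<le> n" for \<eta> i r y
    using that(1)
  proof (induction arbitrary: r)
    case (base y)
    then show ?case using W_E E_\<Phi> that(2) by blast
  next
    case (lower y j s)
    let ?c = "qpow t (of_int (sg Neg * cartan_matrix n i j))"
    \<comment> \<open>The terms of the exchange relation in which the Cartan current acts directly on \<open>y\<close>.\<close>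
    define R where "R s r = ?c *\<^sub>\<complex> X Neg j (s - 1) (\<Phi> \<eta> i r y) - X Neg j s (\<Phi> \<eta> i (r - 1) y)" for s r
    have R: "R s r \<in> ?W" for s r
      unfolding R_def using lower lowering_span_stable by (intro cvec.span_diff cvec.span_scale) auto
    have \<Phi>_R: "\<Phi> \<eta> i r (X Neg j (s - 1) y) = ?c *\<^sub>\<complex> \<Phi> \<eta> i (r - 1) (X Neg j s y) + R s r" for s r
      using \<Phi>_X[of i j \<eta> r Neg s y] lower that(2) by (simp add: R_def algebra_simps)
    have "\<forall>s. \<Phi> \<eta> i r (X Neg j s y) \<in> ?W"
    proof (rule mode_induct[where P = "\<lambda>r. \<forall>s. \<Phi> \<eta> i r (X Neg j s y) \<in> ?W"])
      show "\<forall>s. \<Phi> \<eta> i (- sg \<eta>) (X Neg j s y) \<in> ?W"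
        by (simp add: cvec.span_zero)
      show "(\<forall>s. \<Phi> \<eta> i (r - 1) (X Neg j s y) \<in> ?W) \<longleftrightarrow> (\<forall>s. \<Phi> \<eta> i r (X Neg j s y) \<in> ?W)" for r
      proof
        assume "\<forall>s. \<Phi> \<eta> i (r - 1) (X Neg j s y) \<in> ?W"
        then have "\<Phi> \<eta> i r (X Neg j ((s + 1) - 1) y) \<in> ?W" for s
          unfolding \<Phi>_R by (intro cvec.span_add cvec.span_scale R) blast
        then show "\<forall>s. \<Phi> \<eta> i r (X Neg j s y) \<in> ?W" by simp
      next
        assume *: "\<forall>s. \<Phi> \<eta> i r (X Neg j s y) \<in> ?W"
        have "\<Phi> \<eta> i (r - 1) (X Neg j s y) = inverse ?c *\<^sub>\<complex> (\<Phi> \<eta> i r (X Neg j (s - 1) y) - R s r)" for s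
          unfolding \<Phi>_R by simp
        then show "\<forall>s. \<Phi> \<eta> i (r - 1) (X Neg j s y) \<in> ?W"
          using * R by (auto intro!: cvec.span_scale cvec.span_diff)
      qed
    qed
    then show ?case by blast
  qed
  have orbit_X: "X Pos i r y \<in> ?W" if "y \<in> lowering_orbit E" "i \<le> n" for i r y
    using that(1)
  proof induction
    case (base y)
    then show ?case using singular that(2) by (simp add: cvec.span_zero)
  next
    case (lower y j s)
    then show ?case
      using that(2) orbit_\<Phi>[OF lower(1)] lowering_span_stable
      by (auto simp: X_bracket intro!: cvec.span_add cvec.span_scale cvec.span_diff)
  qed
  show "cvec.subspace ?W" by (rule cvec.subspace_span)
  show "K h v \<in> ?W" if "h \<in> cartan_algebra n" "v \<in> ?W" for h v
    using that by (auto intro: act_maps_span orbit_K)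
  show "\<Phi> \<eta> i m v \<in> ?W" if "i \<le> n" "v \<in> ?W" for \<eta> i m v
    using that by (auto intro: act_maps_span orbit_\<Phi>)
  show "X \<epsilon> i r v \<in> ?W" if "i \<le> n" "v \<in> ?W" for \<epsilon> i r v
    using that by (cases \<epsilon>) (auto intro: act_maps_span orbit_X lowering_span_stable)
qed

lemma K_rho_X:
  assumes "n \<ge> 2" "j \<le> n"
  shows "K (rho n) (X \<epsilon> j r v) = exp t powi sg \<epsilon> *\<^sub>\<complex> X \<epsilon> j r (K (rho n) v)"
  using assms by (simp add: K_X pairing_simple_root_rho qpow_of_int)

lemma inverse_q_power_neq_1: "m > 0 \<Longrightarrow> inverse (exp t) ^ m \<noteq> 1"
  using q_not_root_of_unity[of m] by (metis power_inverse inverse_1 inverse_inverse_eq)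

text \<open>Lowering operators applied to a singular vector strictly below the top height span a submodule
  that stays below the top height, hence a proper one. The argument is applied to all singular
  vectors of the given height at once, since this space is stable under the Cartan currents,
  whereas a single line need not be.\<close>

lemma singular_vector_eq_0:
  assumes n: "n \<ge> 2" and simple: "simple_module n act"
    and v: "v \<noteq> 0" "K (rho n) v = \<kappa> *\<^sub>\<complex> v" "\<kappa> \<noteq> 0"
    and w: "K (rho n) w = (\<kappa> * inverse (exp t) ^ p) *\<^sub>\<complex> w" "p > 0"
    and singular: "\<And>j r. j \<le> n \<Longrightarrow> X Pos j r w = 0"
  shows "w = 0"
proof -
  define E where "E = {y. K (rho n) y = (\<kappa> * inverse (exp t) ^ p) *\<^sub>\<complex> y \<and>
    (\<forall>j\<le>n. \<forall>r. X Pos j r y = 0)}"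
  let ?W = "cvec.span (lowering_orbit E)"
  have "submodule n act ?W"
  proof (rule lowering_span_submodule)
    show "K h y \<in> E" if "y \<in> E" "h \<in> cartan_algebra n" for y h
    proof -
      have "X Pos j r (K h y) = 0" if "j \<le> n" for j r
      proof -
        have "qpow t (of_int (sg Pos) * pairing (simple_root n j) h) *\<^sub>\<complex> X Pos j r (K h y) = 0"
          using K_X[of h j Pos r y] \<open>y \<in> E\<close> \<open>h \<in> _\<close> that by (simp add: E_def act_vec_0)
        then show ?thesis by simp
      qed
      then show ?thesis
        using that K_K[of "rho n" h y] by (simp add: E_def act_vec_scale)
    qed
    show "\<Phi> \<eta> i r y \<in> E" if "y \<in> E" "i \<le> n" for y \<eta> i r
      using that singular_\<Phi>[of y] K_\<Phi>[of "rho n" i \<eta> r y] by (simp add: E_def act_vec_scale)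
  qed (simp add: E_def)
  then have "?W = {0} \<or> ?W = UNIV"
    using simple by (simp add: simple_module_def)
  moreover have "?W \<noteq> UNIV"
  proof
    assume "?W = UNIV"
    have "\<exists>m. K (rho n) y = (\<kappa> * inverse (exp t) ^ (p + m)) *\<^sub>\<complex> y" if "y \<in> lowering_orbit E" for y
      using that
    proof induction
      case (base y)
      then show ?case by (intro exI[of _ 0]) (simp add: E_def)
    next
      case (lower y j s)
      then obtain m where "K (rho n) y = (\<kappa> * inverse (exp t) ^ (p + m)) *\<^sub>\<complex> y" by blast
      then show ?case
        using lower by (intro exI[of _ "Suc m"]) (simp add: K_rho_X n act_vec_scale power_int_minus mult_ac)
    qed
    moreover have "\<kappa> * inverse (exp t) ^ (p + m) \<noteq> \<kappa>" for m
      using v(3) w(2) inverse_q_power_neq_1[of "p + m"] by simp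
    ultimately have "\<And>y. y \<in> lowering_orbit E \<Longrightarrow> \<exists>\<nu>. \<nu> \<noteq> \<kappa> \<and> K (rho n) y = \<nu> *\<^sub>\<complex> y"
      by blast
    moreover have "Vector_Spaces.linear cscale cscale (K (rho n))"
      by unfold_locales (simp_all add: act_simps)
    ultimately have "v = 0"
      using eigenvector_in_span_eq_0[of "K (rho n)" "lowering_orbit E" \<kappa> v] \<open>?W = UNIV\<close> v(2) by simp
    then show False using v(1) by simp
  qed
  moreover have "w \<in> ?W"
    using w(1) singular by (auto simp: E_def intro!: cvec.span_base base)
  ultimately show ?thesis by auto
qed

end


section \<open>The expansions of the rational function \<open>\<psi>\<close>\<close>

text \<open>The coefficient of \<open>z\<^sup>m\<close> in the expansion of \<open>\<psi>(\<gamma>z)\<close> at \<open>0\<close> or at \<open>\<infinity>\<close>.\<close>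

definition psi_coeff :: "complex \<Rightarrow> complex \<Rightarrow> pm \<Rightarrow> int \<Rightarrow> complex" where
  "psi_coeff t \<gamma> \<eta> m = (if sg \<eta> * m < 0 then 0 else if m = 0 then exp t powi sg \<eta>
     else of_int (sg \<eta>) * (exp t - inverse (exp t)) * \<gamma> powi m)"

lemma psi_coeff_wrong_sign [simp]: "sg \<eta> * m < 0 \<Longrightarrow> psi_coeff t \<gamma> \<eta> m = 0"
  by (simp add: psi_coeff_def)

text \<open>Both expansions satisfy the recursion expressing \<open>(1 - \<gamma>z) \<psi>(\<gamma>z) = q - q\<^sup>-\<^sup>1\<gamma>z\<close>.\<close>

lemma psi_coeff_recursion:
  assumes "\<gamma> \<noteq> 0"
  shows "psi_coeff t \<gamma> \<eta> r - \<gamma> * psi_coeff t \<gamma> \<eta> (r - 1) =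
    (if r = 0 then exp t else if r = 1 then - (inverse (exp t) * \<gamma>) else 0)"
proof -
  have *: "\<gamma> powi r = \<gamma> * \<gamma> powi (r - 1)"
    using power_int_add_1'[of \<gamma> "r - 1"] assms by simp
  have cancel: "\<gamma> * (inverse \<gamma> * x) = x" for x
    using assms by simp
  show ?thesis
    by (cases \<eta>) (auto simp: psi_coeff_def * power_int_minus algebra_simps cancel)
qed

lemma psi_coeff_Pos_minus_Neg:
  "psi_coeff t \<gamma> Pos m - psi_coeff t \<gamma> Neg m = (exp t - inverse (exp t)) * \<gamma> powi m"
  by (auto simp: psi_coeff_def power_int_minus algebra_simps)

lemma fps_divide_eqI:
  fixes F G H :: "complex fps"
  assumes "H * G = F" "G \<noteq> 0"
  shows "F / G = H"
  using assms by auto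

lemma fps_nth_mult_linear:
  "fps_nth (F * fps_of_poly [:d0, d1:]) m = d0 * fps_nth F m + (if m = 0 then 0 else d1 * fps_nth F (m - 1))"
  for F :: "complex fps"
proof -
  have "F * fps_of_poly [:d0, d1:] = fps_const d0 * F + fps_const d1 * (fps_X * F)"
    by (simp add: fps_of_poly_pCons algebra_simps)
  then show ?thesis by simp
qed

text \<open>Multiplying by the denominator turns the claim into \<open>psi_coeff_recursion\<close>. At infinity the
  coefficient of \<open>z\<^bsup>-m\<^esup>\<close> is checked by the recursion at \<open>1 - m\<close>.\<close>

lemma fps_nth_psi_expansion:
  assumes "c \<noteq> 0"
  shows "fps_nth (psi_expansion t \<eta> c) m = psi_coeff t c \<eta> (sg \<eta> * int m)"
proof -
  define H where "H = Abs_fps (\<lambda>m. psi_coeff t c \<eta> (sg \<eta> * int m))"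
  have "psi_expansion t \<eta> c = H"
  proof (cases \<eta>)
    case Pos
    have "H * fps_of_poly [:1, - c:] = fps_of_poly [:exp t, - (inverse (exp t) * c):]"
    proof (rule fps_ext)
      show "fps_nth (H * fps_of_poly [:1, - c:]) m = fps_nth (fps_of_poly [:exp t, - (inverse (exp t) * c):]) m" for m
        using psi_coeff_recursion[OF assms, of t Pos "int m"]
        by (cases m rule: nat.exhaust)
          (auto simp: fps_nth_mult_linear H_def Pos coeff_pCons split: nat.splits)
    qed
    then show ?thesis
      unfolding Pos psi_expansion.simps psi_num_def psi_den_def by (intro fps_divide_eqI) auto
  next
    case Neg
    have refl: "reflect_poly [:1, - c:] = [:- c, 1:]"
      "reflect_poly [:exp t, - (inverse (exp t) * c):] = [:- (inverse (exp t) * c), exp t:]"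
      using assms by (simp_all add: reflect_poly_def)
    have "H * fps_of_poly [:- c, 1:] = fps_of_poly [:- (inverse (exp t) * c), exp t:]"
    proof (rule fps_ext)
      show "fps_nth (H * fps_of_poly [:- c, 1:]) m = fps_nth (fps_of_poly [:- (inverse (exp t) * c), exp t:]) m" for m
        using psi_coeff_recursion[OF assms, of t Neg "1 - int m"]
        by (cases m rule: nat.exhaust)
          (auto simp: fps_nth_mult_linear H_def Neg coeff_pCons split: nat.splits)
    qed
    then show ?thesis
      unfolding Neg psi_expansion.simps psi_num_def psi_den_def refl by (intro fps_divide_eqI) auto
  qed
  then show ?thesis by (simp add: H_def)
qed


section \<open>Lowering a highest weight vector along an induced path\<close>

text \<open>A chain of vertices of the Dynkin diagram that are joined only if consecutive. The off-diagonal
  entries \<open>-1\<close> and \<open>0\<close> of the Cartan matrix also make the vertices distinct.\<close>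

definition induced_path :: "nat \<Rightarrow> (nat \<Rightarrow> nat) \<Rightarrow> nat \<Rightarrow> bool" where
  "induced_path n c L \<longleftrightarrow> (\<forall>k\<le>L. c k \<le> n) \<and>
     (\<forall>k\<le>L. \<forall>j<k. cartan_matrix n (c k) (c j) = (if k = Suc j then -1 else 0))"

text \<open>A simple module with an eigenvector \<open>v\<close> of the height operator, playing the top of the module,
  and a path along which \<open>v\<close> will be lowered.\<close>

locale toroidal_module_with_path = toroidal_module +
  fixes v :: 'a and \<kappa> :: complex and c :: "nat \<Rightarrow> nat" and L :: nat
  assumes n_ge_2: "n \<ge> 2" and simple: "simple_module n act"
    and v: "v \<noteq> 0" "K (rho n) v = \<kappa> *\<^sub>\<complex> v" "\<kappa> \<noteq> 0"
    and path: "induced_path n c L"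
begin

lemma path_le: "k \<le> L \<Longrightarrow> c k \<le> n"
  and path_cartan: "j < k \<Longrightarrow> k \<le> L \<Longrightarrow> cartan_matrix n (c k) (c j) = (if k = Suc j then -1 else 0)"
  using path by (auto simp: induced_path_def)

lemma path_distinct: "j < k \<Longrightarrow> k \<le> L \<Longrightarrow> c k \<noteq> c j"
  using path_cartan[of j k] by (auto simp: cartan_matrix_def split: if_splits)

definition height :: "nat \<Rightarrow> 'a \<Rightarrow> bool" where
  "height p w \<longleftrightarrow> K (rho n) w = (\<kappa> * inverse (exp t) ^ p) *\<^sub>\<complex> w"

lemma height_lower: "height p w \<Longrightarrow> j \<le> n \<Longrightarrow> height (Suc p) (X Neg j s w)"
  by (simp add: height_def K_rho_X n_ge_2 act_vec_scale power_int_minus mult_ac)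

lemma height_combination: "height p w \<Longrightarrow> height p w' \<Longrightarrow> height p (w - d *\<^sub>\<complex> w')"
  by (simp add: height_def act_simps cvec.scale_right_diff_distrib mult.commute)

lemma singular_below_top_eq_0: "height p w \<Longrightarrow> p > 0 \<Longrightarrow> (\<And>i r. i \<le> n \<Longrightarrow> X Pos i r w = 0) \<Longrightarrow> w = 0"
  unfolding height_def using singular_vector_eq_0[OF n_ge_2 simple v] by blast

text \<open>What is known of \<open>u\<close> after lowering along \<open>c 0, \<dots>, c (k - 1)\<close>: the \<open>\<phi>\<close>-currents of the
  colours ahead are trivial, that of colour \<open>c k\<close> is \<open>\<psi>(\<gamma>z)\<close>, and whatever a raising operator
  gives is killed by lowering operators of colours ahead.\<close>

definition path_state :: "nat \<Rightarrow> complex \<Rightarrow> 'a \<Rightarrow> bool" where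
  "path_state k \<gamma> u \<longleftrightarrow> u \<noteq> 0 \<and> height k u \<and>
     (\<forall>\<eta> r. \<Phi> \<eta> (c k) r u = psi_coeff t \<gamma> \<eta> r *\<^sub>\<complex> u) \<and>
     (\<forall>j \<eta> r. k < j \<longrightarrow> j \<le> L \<longrightarrow> \<Phi> \<eta> (c j) r u = (if r = 0 then 1 else 0) *\<^sub>\<complex> u) \<and>
     (\<forall>j r. k \<le> j \<longrightarrow> j \<le> L \<longrightarrow> X Pos (c j) r u = 0) \<and>
     (\<forall>i r j s. i \<le> n \<longrightarrow> k \<le> j \<longrightarrow> j \<le> L \<longrightarrow> X Neg (c j) s (X Pos i r u) = 0)"

lemma path_stateD:
  assumes "path_state k \<gamma> u"
  shows "u \<noteq> 0" "height k u" "\<Phi> \<eta> (c k) r u = psi_coeff t \<gamma> \<eta> r *\<^sub>\<complex> u"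
    "k < j \<Longrightarrow> j \<le> L \<Longrightarrow> \<Phi> \<eta> (c j) r u = (if r = 0 then 1 else 0) *\<^sub>\<complex> u"
    "k \<le> j \<Longrightarrow> j \<le> L \<Longrightarrow> X Pos (c j) r u = 0"
    "i \<le> n \<Longrightarrow> k \<le> j \<Longrightarrow> j \<le> L \<Longrightarrow> X Neg (c j) s (X Pos i r u) = 0"
  using assms unfolding path_state_def by blast+

text \<open>A colour \<open>c j\<close> further ahead has weight \<open>0\<close> on \<open>u\<close> and equal currents \<open>\<phi>\<^sup>+\<close> and \<open>\<phi>\<^sup>-\<close>, so by the bracket
  relation the lowered vector is singular.\<close>

lemma lower_ahead_eq_0:
  assumes st: "path_state k \<gamma> u" and j: "k < j" "j \<le> L"
  shows "X Neg (c j) r u = 0"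
proof (rule singular_below_top_eq_0)
  show "height (Suc k) (X Neg (c j) r u)"
    using path_stateD(2)[OF st] j by (intro height_lower path_le)
  show "X Pos i s (X Neg (c j) r u) = 0" if "i \<le> n" for i s
    using that j path_le[of j] path_stateD(4,6)[OF st] by (auto simp: X_bracket)
qed simp

text \<open>The bracket gives \<open>\<phi>\<^sup>+ - \<phi>\<^sup>-\<close>, the difference of the two expansions of \<open>\<psi>(\<gamma>z)\<close>, which is a multiple of
  a delta function.\<close>

lemma raise_lower_path:
  assumes st: "path_state k \<gamma> u" and k: "k \<le> L" and i: "i \<le> n"
  shows "X Pos i s (X Neg (c k) r u) = (if i = c k then \<gamma> powi (s + r) else 0) *\<^sub>\<complex> u"
proof -
  have "\<Phi> Pos (c k) m u - \<Phi> Neg (c k) m u = ((exp t - inverse (exp t)) * \<gamma> powi m) *\<^sub>\<complex> u" for m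
    unfolding path_stateD(3)[OF st] psi_coeff_Pos_minus_Neg[symmetric] cvec.scale_left_diff_distrib ..
  then show ?thesis
    using path_le[OF k] path_stateD(6)[OF st i order_refl k] i q_minus_inverse_nonzero by (simp add: X_bracket)
qed

text \<open>The current \<open>x\<^sup>-\<^bsub>c k\<^esub>(z)\<close> acts on \<open>u\<close> as a delta function at the pole of \<open>\<psi>(\<gamma>z)\<close>, because
  \<open>x\<^sup>-\<^bsub>c k,r\<^esub> u - \<gamma> x\<^sup>-\<^bsub>c k,r-1\<^esub> u\<close> is singular by \<open>raise_lower_path\<close>.\<close>

lemma lower_path:
  assumes st: "path_state k \<gamma> u" and k: "k \<le> L" and \<gamma>: "\<gamma> \<noteq> 0"
  shows "X Neg (c k) r u = \<gamma> powi r *\<^sub>\<complex> X Neg (c k) 0 u"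
proof -
  have step: "X Neg (c k) r u = \<gamma> *\<^sub>\<complex> X Neg (c k) (r - 1) u" for r
  proof -
    have "X Neg (c k) r u - \<gamma> *\<^sub>\<complex> X Neg (c k) (r - 1) u = 0"
    proof (rule singular_below_top_eq_0)
      show "height (Suc k) (X Neg (c k) r u - \<gamma> *\<^sub>\<complex> X Neg (c k) (r - 1) u)"
        using path_stateD(2)[OF st] k by (intro height_combination height_lower path_le)
      show "X Pos i s (X Neg (c k) r u - \<gamma> *\<^sub>\<complex> X Neg (c k) (r - 1) u) = 0" if "i \<le> n" for i s
        using that \<gamma> power_int_add_1'[of \<gamma> "s + r - 1"]
        by (simp add: act_simps raise_lower_path[OF st k] add_diff_eq)
    qed simp
    then show ?thesis by simp
  qed
  show ?thesis
  proof (rule mode_induct[where P = "\<lambda>r. X Neg (c k) r u = \<gamma> powi r *\<^sub>\<complex> X Neg (c k) 0 u" and m = 0])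
    show "(X Neg (c k) (r - 1) u = \<gamma> powi (r - 1) *\<^sub>\<complex> X Neg (c k) 0 u) \<longleftrightarrow>
        (X Neg (c k) r u = \<gamma> powi r *\<^sub>\<complex> X Neg (c k) 0 u)" for r
    proof -
      have "\<gamma> powi r *\<^sub>\<complex> X Neg (c k) 0 u = \<gamma> *\<^sub>\<complex> (\<gamma> powi (r - 1) *\<^sub>\<complex> X Neg (c k) 0 u)"
        using power_int_add_1'[of \<gamma> "r - 1"] \<gamma> by simp
      then show ?thesis
        unfolding step[of r] using \<gamma> by (simp only: cvec.scale_left_imp_eq cvec.scale_cancel_left) simp
    qed
  qed simp
qed

text \<open>Raising back returns \<open>u\<close>.\<close>

lemma lower_path_nonzero:
  assumes st: "path_state k \<gamma> u" and k: "k \<le> L"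
  shows "X Neg (c k) 0 u \<noteq> 0"
proof
  assume "X Neg (c k) 0 u = 0"
  then have "u = 0"
    using raise_lower_path[OF st k path_le[OF k], of 0 0] path_le[OF k] by (simp add: act_vec_0)
  then show False using path_stateD(1)[OF st] by simp
qed

text \<open>A sequence satisfying a two-term recursion is determined by one value, here the vanishing one on
  the wrong side of \<open>0\<close>. This covers both expansions of a rational eigenvalue at once.\<close>

lemma \<Phi>_recursion_unique:
  assumes f: "f (- sg \<eta>) = 0"
    and y: "\<And>r. \<Phi> \<eta> i r y - d *\<^sub>\<complex> \<Phi> \<eta> i (r - 1) y = (f r - d * f (r - 1)) *\<^sub>\<complex> y"
    and d: "d \<noteq> 0"
  shows "\<Phi> \<eta> i r y = f r *\<^sub>\<complex> y"
proof (rule mode_induct[where P = "\<lambda>r. \<Phi> \<eta> i r y = f r *\<^sub>\<complex> y"])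
  show "\<Phi> \<eta> i (- sg \<eta>) y = f (- sg \<eta>) *\<^sub>\<complex> y" using f by simp
  show "(\<Phi> \<eta> i (r - 1) y = f (r - 1) *\<^sub>\<complex> y) \<longleftrightarrow> (\<Phi> \<eta> i r y = f r *\<^sub>\<complex> y)" for r
  proof -
    have "\<Phi> \<eta> i r y - f r *\<^sub>\<complex> y = d *\<^sub>\<complex> (\<Phi> \<eta> i (r - 1) y - f (r - 1) *\<^sub>\<complex> y)"
      using y[of r] by (simp add: cvec.scale_right_diff_distrib cvec.scale_left_diff_distrib algebra_simps)
    then have "\<Phi> \<eta> i r y - f r *\<^sub>\<complex> y = 0 \<longleftrightarrow> \<Phi> \<eta> i (r - 1) y - f (r - 1) *\<^sub>\<complex> y = 0"
      using d by (simp only: cvec.scale_eq_0_iff) simp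
    then show ?thesis by simp
  qed
qed

text \<open>A trivial current becomes \<open>\<psi>(q\<gamma>z)\<close> when the neighbouring colour is lowered at \<open>\<gamma>\<close>, and
  stays trivial when a colour that is not adjacent is lowered.\<close>

lemma \<Phi>_after_lowering:
  assumes st: "path_state k \<gamma> u" and j: "k < j" "j \<le> L" and \<gamma>: "\<gamma> \<noteq> 0"
  shows "\<Phi> \<eta> (c j) r (X Neg (c k) 0 u) =
    (if j = Suc k then psi_coeff t (exp t * \<gamma>) \<eta> r else if r = 0 then 1 else 0) *\<^sub>\<complex> X Neg (c k) 0 u"
proof -
  define u' where "u' = X Neg (c k) 0 u"
  define d where "d = (if j = Suc k then exp t else 1)"
  have k: "k \<le> L" using j by simp
  have d: "qpow t (of_int (sg Neg * cartan_matrix n (c j) (c k))) = d"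
    using path_cartan[OF j] qpow_of_int[of t 1] qpow_of_int[of t 0] by (simp add: d_def)
  have lower_1: "X Neg (c k) 1 u = \<gamma> *\<^sub>\<complex> X Neg (c k) 0 u"
    using lower_path[OF st k \<gamma>, of 1] by simp
  have rel: "\<Phi> \<eta> (c j) r u' - (d * \<gamma>) *\<^sub>\<complex> \<Phi> \<eta> (c j) (r - 1) u' =
      ((if r = 0 then d else 0) - (if r = 1 then \<gamma> else 0)) *\<^sub>\<complex> u'" for r
    using \<Phi>_X[of "c j" "c k" \<eta> r Neg 1 u] path_le[OF k] path_le[OF j(2)]
    unfolding d by (auto simp: act_simps u'_def lower_1 path_stateD(4)[OF st j])
  show ?thesis
  proof (cases "j = Suc k")
    case True
    have "\<Phi> \<eta> (c j) r u' = psi_coeff t (exp t * \<gamma>) \<eta> r *\<^sub>\<complex> u'"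
    proof (rule \<Phi>_recursion_unique[where d = "exp t * \<gamma>"])
      show "\<Phi> \<eta> (c j) r u' - (exp t * \<gamma>) *\<^sub>\<complex> \<Phi> \<eta> (c j) (r - 1) u' =
          (psi_coeff t (exp t * \<gamma>) \<eta> r - (exp t * \<gamma>) * psi_coeff t (exp t * \<gamma>) \<eta> (r - 1)) *\<^sub>\<complex> u'" for r
        using rel[of r] \<gamma> psi_coeff_recursion[of "exp t * \<gamma>" t \<eta> r] True by (auto simp: d_def)
    qed (use \<gamma> in \<open>cases \<eta>; auto\<close>)+
    then show ?thesis using True by (simp add: u'_def)
  next
    case False
    have "\<Phi> \<eta> (c j) r u' = (if r = 0 then 1 else 0) *\<^sub>\<complex> u'"
    proof (rule \<Phi>_recursion_unique[where d = \<gamma> and f = "\<lambda>r. if r = 0 then 1 else 0"])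
      show "\<Phi> \<eta> (c j) r u' - \<gamma> *\<^sub>\<complex> \<Phi> \<eta> (c j) (r - 1) u' =
          ((if r = 0 then 1 else 0) - \<gamma> * (if r - 1 = 0 then 1 else 0)) *\<^sub>\<complex> u'" for r
        using rel[of r] False by (auto simp: d_def)
    qed (use \<gamma> in \<open>cases \<eta>; auto\<close>)+
    then show ?thesis using False by (simp add: u'_def)
  qed
qed

lemma path_state_Suc:
  assumes st: "path_state k \<gamma> u" and k: "k < L" and \<gamma>: "\<gamma> \<noteq> 0"
  shows "path_state (Suc k) (exp t * \<gamma>) (X Neg (c k) 0 u)"
proof -
  have k': "k \<le> L" using k by simp
  have "X Neg (c j) s (X Pos i r (X Neg (c k) 0 u)) = 0" if "i \<le> n" "Suc k \<le> j" "j \<le> L" for i r j s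
    using that lower_ahead_eq_0[OF st, of j] path_le[of j]
    by (simp add: raise_lower_path[OF st k'] act_vec_scale act_vec_0)
  moreover have "X Pos (c j) r (X Neg (c k) 0 u) = 0" if "Suc k \<le> j" "j \<le> L" for j r
    using that path_distinct[of k j] path_le[of j] by (simp add: raise_lower_path[OF st k'])
  ultimately show ?thesis
    unfolding path_state_def
    using lower_path_nonzero[OF st k'] height_lower[OF path_stateD(2)[OF st] path_le[OF k']] k
    by (auto simp: \<Phi>_after_lowering[OF st _ _ \<gamma>])
qed

primrec path_vector :: "nat \<Rightarrow> 'a" where
  "path_vector 0 = v"
| "path_vector (Suc k) = X Neg (c k) 0 (path_vector k)"

lemma path_state_path_vector:
  assumes "path_state 0 \<gamma> v" "\<gamma> \<noteq> 0" "k \<le> L"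
  shows "path_state k (exp t ^ k * \<gamma>) (path_vector k)"
  using assms(3)
proof (induction k)
  case (Suc k)
  then show ?case
    using path_state_Suc[of k "exp t ^ k * \<gamma>"] assms(2) by (simp add: mult.assoc)
qed (use assms in simp)

end


section \<open>Linear functionals on tensor products\<close>

abbreviation clinear_functional :: "('a::complex_vec \<Rightarrow> complex) \<Rightarrow> bool" where
  "clinear_functional \<equiv> Vector_Spaces.linear cscale (*)"

lemma clinear_functionalD:
  assumes "clinear_functional f"
  shows "f (x + y) = f x + f y" "f (c *\<^sub>\<complex> x) = c * f x" "f (x - y) = f x - f y" "f 0 = 0"
    "f (sum g A) = (\<Sum>i\<in>A. f (g i))"
proof -
  interpret f: Vector_Spaces.linear cscale "(*)" f by (rule assms)
  show "f (x + y) = f x + f y" "f (c *\<^sub>\<complex> x) = c * f x" "f (x - y) = f x - f y" "f 0 = 0"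
    "f (sum g A) = (\<Sum>i\<in>A. f (g i))"
    by (rule f.add f.scale f.diff f.zero f.sum)+
qed

lemma ex_functional_eq_1:
  assumes "x \<noteq> 0"
  shows "\<exists>f. clinear_functional f \<and> f x = 1"
proof -
  have ind: "cvec.independent {x}" using assms by simp
  define B where "B = cvec.extend_basis {x}"
  have B: "cvec.independent B" "x \<in> B" "cvec.span B = UNIV"
    using cvec.independent_extend_basis[OF ind] cvec.extend_basis_superset[OF ind]
      cvec.span_extend_basis[OF ind] by (auto simp: B_def)
  have "clinear_functional (\<lambda>v. cvec.representation B v x)"
    by unfold_locales
      (simp_all add: B cvec.representation_add cvec.representation_scale algebra_simps)
  moreover have "cvec.representation B x x = 1"
    using B by (simp add: cvec.representation_basis)
  ultimately show ?thesis by blast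
qed

definition extend_linearly :: "('k \<Rightarrow> complex) \<Rightarrow> ('k \<Rightarrow>\<^sub>0 complex) \<Rightarrow> complex" where
  "extend_linearly f p = (\<Sum>k\<in>Poly_Mapping.keys p. Poly_Mapping.lookup p k * f k)"

lemma extend_linearly_superset:
  "finite A \<Longrightarrow> Poly_Mapping.keys p \<subseteq> A \<Longrightarrow> extend_linearly f p = (\<Sum>k\<in>A. Poly_Mapping.lookup p k * f k)"
  unfolding extend_linearly_def by (rule sum.mono_neutral_left) (auto simp: in_keys_iff)

lemma extend_linearly_simps:
  "extend_linearly f (p + p') = extend_linearly f p + extend_linearly f p'"
  "extend_linearly f (p - p') = extend_linearly f p - extend_linearly f p'"
  "extend_linearly f (fscale c p) = c * extend_linearly f p"
  "extend_linearly f (fsingle k) = f k"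
  "extend_linearly f 0 = 0"
proof -
  let ?A = "Poly_Mapping.keys p \<union> Poly_Mapping.keys p'"
  have eq: "extend_linearly f r = (\<Sum>k\<in>?A. Poly_Mapping.lookup r k * f k)" if "Poly_Mapping.keys r \<subseteq> ?A" for r
    using that by (intro extend_linearly_superset) auto
  have k: "Poly_Mapping.keys (p + p') \<subseteq> ?A" "Poly_Mapping.keys (p - p') \<subseteq> ?A" "Poly_Mapping.keys (fscale c p) \<subseteq> ?A"
    by (auto simp: in_keys_iff lookup_add lookup_minus lookup_fscale)
  show "extend_linearly f (p + p') = extend_linearly f p + extend_linearly f p'"
    "extend_linearly f (p - p') = extend_linearly f p - extend_linearly f p'"
    "extend_linearly f (fscale c p) = c * extend_linearly f p"
    using k by (simp_all add: eq lookup_add lookup_minus lookup_fscale sum.distrib sum_subtractf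
        sum_distrib_left algebra_simps)
  show "extend_linearly f (fsingle k) = f k" "extend_linearly f 0 = 0"
    by (simp_all add: extend_linearly_def)
qed

lemma extend_linearly_bilinear_relators:
  assumes f: "clinear_functional f" and g: "clinear_functional g"
    and p: "p \<in> fvec.span bilinear_relators"
  shows "extend_linearly (\<lambda>(v, w). f v * g w) p = 0"
  using p
proof (induction rule: fvec.span_induct)
  case base
  show ?case by (rule fvec.subspaceI) (simp_all add: extend_linearly_simps)
next
  case (step x)
  then show ?case
    by (auto simp: bilinear_relators_def extend_linearly_simps clinear_functionalD[OF f]
        clinear_functionalD[OF g] ring_distribs)
qed

text \<open>The functional \<open>f \<otimes> g\<close>. The default value \<open>0\<close> for nonlinear arguments makes the definition respect the
  relations of the tensor product without hypotheses. Such functionals detect that a tensor of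
  nonzero vectors is nonzero and reduce vector-valued series to scalar ones.\<close>

lift_definition tensor_functional ::
    "('a::complex_vec \<Rightarrow> complex) \<Rightarrow> ('b::complex_vec \<Rightarrow> complex) \<Rightarrow> ('a, 'b) tensor \<Rightarrow> complex"
  is "\<lambda>f g p. if clinear_functional f \<and> clinear_functional g
    then extend_linearly (\<lambda>(v, w). f v * g w) p else 0"
proof -
  fix f :: "'a \<Rightarrow> complex" and g :: "'b \<Rightarrow> complex" and p p' :: "'a \<times> 'b \<Rightarrow>\<^sub>0 complex"
  assume "tensor_eq p p'"
  then have "clinear_functional f \<Longrightarrow> clinear_functional g \<Longrightarrow>
      extend_linearly (\<lambda>(v, w). f v * g w) (p - p') = 0"
    unfolding tensor_eq_def by (intro extend_linearly_bilinear_relators)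
  then show "(if clinear_functional f \<and> clinear_functional g
      then extend_linearly (\<lambda>(v, w). f v * g w) p else 0) =
    (if clinear_functional f \<and> clinear_functional g
      then extend_linearly (\<lambda>(v, w). f v * g w) p' else 0)"
    by (simp add: extend_linearly_simps)
qed

lemma tensor_functional_tens:
  "clinear_functional f \<Longrightarrow> clinear_functional g \<Longrightarrow> tensor_functional f g (v \<otimes> w) = f v * g w"
  by transfer (simp add: extend_linearly_simps)

lemma clinear_tensor_functional:
  assumes "clinear_functional f" "clinear_functional g"
  shows "clinear_functional (tensor_functional f g)"
proof -
  have "tensor_functional f g (x + y) = tensor_functional f g x + tensor_functional f g y" for x y
    using assms by transfer (simp add: extend_linearly_simps)
  moreover have "tensor_functional f g (c *\<^sub>\<complex> x) = c * tensor_functional f g x" for c x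
    using assms by transfer (simp add: extend_linearly_simps)
  ultimately show ?thesis
    by unfold_locales (simp_all add: algebra_simps)
qed

lemma tens_nonzero:
  assumes "x \<noteq> 0" "y \<noteq> 0"
  shows "x \<otimes> y \<noteq> 0"
proof -
  obtain f where f: "clinear_functional f" "f x = 1"
    using ex_functional_eq_1[OF assms(1)] by blast
  obtain g where g: "clinear_functional g" "g y = 1"
    using ex_functional_eq_1[OF assms(2)] by blast
  have "tensor_functional f g (x \<otimes> y) = 1"
    using f g by (simp add: tensor_functional_tens)
  moreover have "tensor_functional f g 0 = 0"
    by (rule clinear_functionalD(4)[OF clinear_tensor_functional[OF f(1) g(1)]])
  ultimately show ?thesis by (metis zero_neq_one)
qed

lemma tens_0 [simp]: "0 \<otimes> y = 0" "x \<otimes> 0 = 0"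
  using tens_scale_left[of 0 0 y] tens_scale_right[of x 0 0] by simp_all


section \<open>Values of regularized series\<close>

text \<open>Applying a linear functional turns a regularized value in the sense of \<open>rational_value_at_1\<close> into
  the value at \<open>1\<close> of a quotient \<open>N / D\<close> of ordinary polynomials.\<close>

lemma rational_value_functional:
  assumes F: "rational_value_at_1 F y" "\<And>k. k < 0 \<Longrightarrow> F k = 0" and f: "clinear_functional f"
  obtains D N :: "complex poly" where "poly D 1 \<noteq> 0"
    "fps_of_poly D * Abs_fps (\<lambda>m. f (F (int m))) = fps_of_poly N"
    "poly D 1 * f y = poly N 1"
proof -
  obtain D :: "complex poly" and M where D: "poly D 1 \<noteq> 0"
      "\<And>k. (\<Sum>j\<le>degree D. coeff D j *\<^sub>\<complex> F (k - int j)) = Poly_Mapping.lookup M k"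
      "poly D 1 *\<^sub>\<complex> y = (\<Sum>k\<in>Poly_Mapping.keys M. Poly_Mapping.lookup M k)"
    using F(1) unfolding rational_value_at_1_def by blast
  define N where "N = (\<Sum>k\<in>Poly_Mapping.keys M. monom (f (Poly_Mapping.lookup M k)) (nat k))"
  have nonneg: "k \<ge> 0" if "k \<in> Poly_Mapping.keys M" for k
  proof (rule ccontr)
    assume "\<not> k \<ge> 0"
    then have "(\<Sum>j\<le>degree D. coeff D j *\<^sub>\<complex> F (k - int j)) = 0"
      using F(2) by (intro sum.neutral) auto
    then show False using that D(2)[of k] by (simp add: in_keys_iff)
  qed
  have coeff_N: "coeff N m = f (Poly_Mapping.lookup M (int m))" for m
  proof -
    have "coeff N m = (\<Sum>k\<in>Poly_Mapping.keys M. if nat k = m then f (Poly_Mapping.lookup M k) else 0)"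
      by (simp add: N_def coeff_sum)
    also have "\<dots> = (\<Sum>k\<in>Poly_Mapping.keys M. if k = int m then f (Poly_Mapping.lookup M k) else 0)"
      using nonneg by (intro sum.cong) auto
    also have "\<dots> = f (Poly_Mapping.lookup M (int m))"
      by (auto simp: sum.delta in_keys_iff clinear_functionalD[OF f])
    finally show ?thesis .
  qed
  have "fps_of_poly D * Abs_fps (\<lambda>m. f (F (int m))) = fps_of_poly N"
  proof (rule fps_ext)
    fix m
    have "f (Poly_Mapping.lookup M (int m)) = (\<Sum>j\<le>degree D. coeff D j * f (F (int m - int j)))"
      unfolding D(2)[symmetric] by (simp add: clinear_functionalD[OF f])
    also have "\<dots> = (\<Sum>j\<le>max m (degree D). coeff D j * f (F (int m - int j)))"
      by (rule sum.mono_neutral_left) (auto simp: coeff_eq_0)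
    also have "\<dots> = (\<Sum>j\<le>m. coeff D j * f (F (int m - int j)))"
      by (rule sum.mono_neutral_right) (auto simp: F(2) clinear_functionalD[OF f])
    also have "\<dots> = fps_nth (fps_of_poly D * Abs_fps (\<lambda>m. f (F (int m)))) m"
      by (auto simp: fps_mult_nth atMost_atLeast0 of_nat_diff intro!: sum.cong)
    finally show "fps_nth (fps_of_poly D * Abs_fps (\<lambda>m. f (F (int m)))) m = fps_nth (fps_of_poly N) m"
      by (simp add: coeff_N)
  qed
  moreover have "poly D 1 * f y = poly N 1"
  proof -
    have "poly D 1 * f y = f (poly D 1 *\<^sub>\<complex> y)" by (simp add: clinear_functionalD[OF f])
    also have "\<dots> = (\<Sum>k\<in>Poly_Mapping.keys M. f (Poly_Mapping.lookup M k))"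
      unfolding D(3) by (rule clinear_functionalD[OF f])
    also have "\<dots> = poly N 1" by (simp add: N_def poly_sum poly_monom)
    finally show ?thesis .
  qed
  ultimately show ?thesis using that D(1) by blast
qed

lemma rational_value_constant:
  assumes "rational_value_at_1 (\<lambda>k. if k = 0 then e else 0) y"
  shows "y = e"
proof (rule ccontr)
  assume "y \<noteq> e"
  then obtain f where f: "clinear_functional f" "f (y - e) = 1"
    using ex_functional_eq_1[of "y - e"] by auto
  obtain D N :: "complex poly" where DN: "poly D 1 \<noteq> 0"
      "fps_of_poly D * Abs_fps (\<lambda>m. f (if int m = 0 then e else 0)) = fps_of_poly N"
      "poly D 1 * f y = poly N 1"
    by (rule rational_value_functional[OF assms _ f(1)]) simp_all
  have "Abs_fps (\<lambda>m. f (if int m = 0 then e else 0)) = fps_of_poly [:f e:]"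
    by (rule fps_ext) (simp add: clinear_functionalD[OF f(1)] coeff_pCons split: nat.splits)
  then have "fps_of_poly (D * [:f e:]) = fps_of_poly N"
    using DN(2) by (simp only: fps_of_poly_mult)
  then have "D * [:f e:] = N" by (simp only: fps_of_poly_eq_iff)
  then have "poly N 1 = poly D 1 * f e" by auto
  then have "f y = f e" using DN(1,3) by simp
  then show False using f by (simp add: clinear_functionalD)
qed

text \<open>If the regularized value is \<open>0\<close>, then \<open>N\<close> vanishes at \<open>1\<close>; comparing \<open>N / D\<close> with \<open>R / P\<close> gives
  \<open>D R = N P\<close>, whose value at \<open>1\<close> shows that \<open>R\<close> vanishes there as well.\<close>

lemma rational_value_eq_0:
  assumes val: "rational_value_at_1 (\<lambda>k. (if k \<ge> 0 then g (nat k) else 0) *\<^sub>\<complex> e) 0" and e: "e \<noteq> 0"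
    and g: "Abs_fps g * fps_of_poly P = fps_of_poly R"
  shows "poly R 1 = 0"
proof -
  obtain f where f: "clinear_functional f" "f e = 1"
    using ex_functional_eq_1[OF e] by blast
  obtain D N :: "complex poly" where DN: "poly D 1 \<noteq> 0"
      "fps_of_poly D * Abs_fps (\<lambda>m. f ((if int m \<ge> 0 then g (nat (int m)) else 0) *\<^sub>\<complex> e)) = fps_of_poly N"
      "poly D 1 * f 0 = poly N 1"
    by (rule rational_value_functional[OF val _ f(1)]) simp_all
  have "fps_of_poly D * Abs_fps g = fps_of_poly N"
    using DN(2) f by (simp add: clinear_functionalD)
  then have "fps_of_poly (D * R) = fps_of_poly (N * P)"
    unfolding fps_of_poly_mult g[symmetric] by (simp add: mult.assoc)
  then have "D * R = N * P" by (simp only: fps_of_poly_eq_iff)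
  then have "poly D 1 * poly R 1 = poly N 1 * poly P 1" by (metis poly_mult)
  moreover have "poly N 1 = 0" using DN(3) f by (simp add: clinear_functionalD)
  ultimately show ?thesis using DN(1) by simp
qed


section \<open>The orbit of the tensor product of the extreme vectors\<close>

lemma exp_powi_inj:
  fixes t :: complex
  assumes "\<And>m::nat. m > 0 \<Longrightarrow> exp t ^ m \<noteq> 1" "exp t powi j = exp t powi k"
  shows "j = k"
proof (rule ccontr)
  have one: "m = 0" if "exp t powi int m = 1" for m
    using assms(1)[of m] that by (cases "m = 0") auto
  assume "j \<noteq> k"
  have "exp t powi (j - k) = 1" "exp t powi (k - j) = 1"
    using assms(2) by (simp_all add: power_int_diff[of "exp t" j k] power_int_diff[of "exp t" k j])
  then have "exp t powi int (nat \<bar>j - k\<bar>) = 1"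
    by (cases "j \<ge> k") simp_all
  then show False using one \<open>j \<noteq> k\<close> by fastforce
qed

lemma pairing_coroot: "pairing \<mu> (coroot i) = \<mu> (Co i)"
  by (simp add: pairing_def coroot_def)

lemma V_highest_nonzero: "is_V_highest n t l a act v \<Longrightarrow> v \<noteq> 0"
  and V_lowest_nonzero: "is_V_lowest n t b act v \<Longrightarrow> v \<noteq> 0"
proof -
  have "v \<noteq> 0" if "tor_module n t act" "simple_module n act" "generated_submodule n act v = UNIV"
  proof
    assume "v = 0"
    have "act u 0 = 0" if "u \<in> free_algebra n" for u
      using \<open>tor_module n t act\<close> that unfolding tor_module_def by (metis cvec.scale_zero_left)
    then have "generated_submodule n act v \<subseteq> {0}"
      using \<open>v = 0\<close> by (auto simp: generated_submodule_def)
    then show False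
      using that by (auto simp: simple_module_def)
  qed
  then show "is_V_highest n t l a act v \<Longrightarrow> v \<noteq> 0" "is_V_lowest n t b act v \<Longrightarrow> v \<noteq> 0"
    unfolding is_V_highest_def is_V_lowest_def by blast+
qed

lemma inverse_psi_mult_num:
  "inverse (psi_expansion t Pos (b * exp t)) * fps_of_poly [:exp t, - b:] = fps_of_poly [:1, - (b * exp t):]"
proof -
  let ?N = "fps_of_poly [:exp t, - b:]" and ?D = "fps_of_poly [:1, - (b * exp t):]"
  define \<psi> where "\<psi> = ?N / ?D"
  have \<psi>: "psi_expansion t Pos (b * exp t) = \<psi>"
  proof -
    have "inverse (exp t) * (b * exp t) = b" by (simp add: field_simps)
    then show ?thesis by (simp only: \<psi>_def psi_expansion.simps psi_num_def psi_den_def)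
  qed
  have D: "fps_nth ?D 0 \<noteq> 0" by simp
  have \<psi>D: "\<psi> * ?D = ?N"
    unfolding \<psi>_def fps_divide_unit[OF D] using inverse_mult_eq_1[OF D] by (simp add: mult.assoc)
  have "fps_nth \<psi> 0 * fps_nth ?D 0 = fps_nth ?N 0"
    unfolding \<psi>D[symmetric] by simp
  then have "fps_nth \<psi> 0 \<noteq> 0" by auto
  then have "inverse \<psi> * (\<psi> * ?D) = ?D"
    using inverse_mult_eq_1[of \<psi>] by (simp flip: mult.assoc)
  then show ?thesis unfolding \<psi> \<psi>D .
qed

locale extremal_tensor_along_path =
  fixes n l :: nat and t a b :: complex
    and act1 :: "free_alg \<Rightarrow> 'v::complex_vec \<Rightarrow> 'v" and v1 :: 'v
    and act2 :: "free_alg \<Rightarrow> 'w::complex_vec \<Rightarrow> 'w" and v2 :: 'w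
    and act :: "free_alg \<Rightarrow> ('v, 'w) tensor \<Rightarrow> ('v, 'w) tensor"
    and c :: "nat \<Rightarrow> nat" and L :: nat
  assumes n: "n \<ge> 2"
    and q_not_root: "\<And>m::nat. m > 0 \<Longrightarrow> exp t ^ m \<noteq> 1"
    and a: "a \<noteq> 0"
    and V1: "is_V_highest n t l a act1 v1"
    and V2: "is_V_lowest n t b act2 v2"
    and tensor: "is_drinfeld_tensor n t act1 act2 act"
    and induced_path: "induced_path n c L"
    and path_0: "c 0 = l" and path_L: "c L = 0"

sublocale extremal_tensor_along_path \<subseteq>
  M: toroidal_module_with_path n t act1 v1 "qpow t (pairing (fund_weight l) (rho n))" c L
  using V1 V_highest_nonzero[OF V1] q_not_root n induced_path
  by unfold_locales (auto simp: is_V_highest_def weight_vector_def)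

context extremal_tensor_along_path
begin

abbreviation u :: "nat \<Rightarrow> 'v" where "u \<equiv> M.path_vector"

text \<open>The spectral parameter at the \<open>k\<close>-th vertex of the path: \<open>\<psi>(a q z)\<close> at the start, then one factor \<open>q\<close>
  for each step.\<close>

definition \<gamma> :: "nat \<Rightarrow> complex" where "\<gamma> k = exp t ^ k * (a * exp t)"

lemma \<gamma>_nonzero [simp]: "\<gamma> k \<noteq> 0"
  using a by (simp add: \<gamma>_def)

lemma path_state_u:
  assumes "k \<le> L"
  shows "M.path_state k (\<gamma> k) (u k)"
proof -
  have raise: "act1 (gx Pos i r) v1 = 0" if "i \<le> n" for i r
    using V1 that by (simp add: is_V_highest_def)
  have \<Phi>: "act1 (phi t \<eta> i r) v1 = (if i = l then psi_coeff t (a * exp t) \<eta> r else if r = 0 then 1 else 0) *\<^sub>\<complex> v1"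
    if "i \<le> n" for \<eta> i r
  proof (cases "sg \<eta> * r < 0")
    case True
    then show ?thesis by (auto simp: M.act_0)
  next
    case False
    then obtain m where r: "r = sg \<eta> * int m"
      by (intro that[of "nat (sg \<eta> * r)"]) (cases \<eta>; simp)
    have "act1 (phi t \<eta> i (sg \<eta> * int m)) v1 =
        fps_nth (if i = l then psi_expansion t \<eta> (a * exp t) else 1) m *\<^sub>\<complex> v1"
      using V1 that by (simp add: is_V_highest_def)
    moreover have "sg \<eta> * int m = 0 \<longleftrightarrow> m = 0"
      by (cases \<eta>) simp_all
    ultimately show ?thesis
      using a by (simp add: fps_nth_psi_expansion r)
  qed
  have "M.path_state 0 (a * exp t) v1"
    unfolding M.path_state_def
    using V_highest_nonzero[OF V1] M.v(2) M.path_le path_0 M.path_distinct[of 0]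
    by (auto simp: M.height_def \<Phi> raise M.act_vec_0)
  then show ?thesis
    using M.path_state_path_vector[of "a * exp t" k] a assms by (simp add: \<gamma>_def)
qed

lemma lowest_\<phi>:
  "i \<le> n \<Longrightarrow> act2 (phi t Pos i (int m)) v2 =
     fps_nth (if i = 0 then inverse (psi_expansion t Pos (b * exp t)) else 1) m *\<^sub>\<complex> v2"
  using V2 unfolding is_V_lowest_def by (metis (no_types, lifting) mult_1 sg.simps(1))

text \<open>The summand \<open>1 \<otimes> x\<^sup>-\<close> of the coproduct vanishes on \<open>v\<^sup>-\<close>. In the other one, the delta function
  \<open>x\<^sup>-\<^bsub>c k\<^esub>(z) u\<^sub>k\<close> evaluates the eigenvalue of \<open>\<phi>\<^sup>+\<^bsub>c k\<^esub>\<close> on \<open>v\<^sup>-\<close> at \<open>1 / \<gamma>\<^sub>k\<close>.\<close>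

lemma lower_tensor:
  assumes "k \<le> L"
  shows "rational_value_at_1 (\<lambda>m. (if m \<ge> 0 then \<gamma> k powi (- m) *
      fps_nth (if c k = 0 then inverse (psi_expansion t Pos (b * exp t)) else 1) (nat m) else 0) *\<^sub>\<complex> (u (Suc k) \<otimes> v2))
    (act (gx Neg (c k) 0) (u k \<otimes> v2))"
proof -
  have ck: "c k \<le> n" using assms by (rule M.path_le)
  have "act2 (gx Neg (c k) 0) v2 = 0"
    using V2 ck by (simp add: is_V_lowest_def)
  moreover have "act2 (phi t Pos (c k) m) v2 =
      fps_nth (if c k = 0 then inverse (psi_expansion t Pos (b * exp t)) else 1) (nat m) *\<^sub>\<complex> v2" if "m \<ge> 0" for m
    using lowest_\<phi>[OF ck, of "nat m"] that by simp
  moreover have "act1 (gx Neg (c k) (- m)) (u k) = \<gamma> k powi (- m) *\<^sub>\<complex> u (Suc k)" for m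
    using M.lower_path[OF path_state_u[OF assms] assms \<gamma>_nonzero, of "- m"]
    by (simp only: M.path_vector.simps)
  ultimately have "coproduct_x_neg_series t act1 act2 (c k) 0 (u k) v2 m =
      (if m \<ge> 0 then \<gamma> k powi (- m) *
      fps_nth (if c k = 0 then inverse (psi_expansion t Pos (b * exp t)) else 1) (nat m) else 0) *\<^sub>\<complex> (u (Suc k) \<otimes> v2)" for m
    by (simp add: coproduct_x_neg_series_def tens_scale_left tens_scale_right)
  moreover have "rational_value_at_1 (coproduct_x_neg_series t act1 act2 (c k) 0 (u k) v2)
      (act (gx Neg (c k) 0) (u k \<otimes> v2))"
    using tensor ck by (simp add: is_drinfeld_tensor_def)
  ultimately show ?thesis by presburger
qed

lemma lower_tensor_interior:
  assumes "k < L"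
  shows "act (gx Neg (c k) 0) (u k \<otimes> v2) = u (Suc k) \<otimes> v2"
proof (rule rational_value_constant)
  have "c k \<noteq> 0" using M.path_distinct[OF assms] path_L by simp
  then show "rational_value_at_1 (\<lambda>m. if m = 0 then u (Suc k) \<otimes> v2 else 0)
      (act (gx Neg (c k) 0) (u k \<otimes> v2))"
    using lower_tensor[of k] assms
    by (auto elim!: back_subst[where P = "\<lambda>F. rational_value_at_1 F _"] simp: fun_eq_iff)
qed

lemma u_tensor_nonzero: "k \<le> L \<Longrightarrow> u k \<otimes> v2 \<noteq> 0"
  using M.path_stateD(1)[OF path_state_u] V_lowest_nonzero[OF V2] by (intro tens_nonzero)

text \<open>The weight at the next colour is read off from the constant term of \<open>\<phi>\<^sup>+\<^bsub>c k\<^esub>\<close>, which is \<open>k\<^bsub>c k\<^esub>\<close>. It is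
  \<open>1\<close> on \<open>u\<^sub>k\<close>, and the second factor subtracts \<open>1\<close> precisely at the end of the path. The
  eigenvalue determines the weight because this is integral and \<open>q\<close> is not a root of unity.\<close>

lemma weight_u_tensor:
  assumes k: "k \<le> L" and \<mu>: "\<mu> \<in> weight_lattice n" "weight_vector n t act \<mu> (u k \<otimes> v2)"
  shows "pairing \<mu> (coroot (c k)) = (if k = L then 0 else 1)"
proof -
  have ck: "c k \<le> n" using k by (rule M.path_le)
  obtain z where z: "pairing \<mu> (coroot (c k)) = of_int z"
    using \<mu>(1) ck by (auto simp: weight_lattice_def elim: Ints_cases)
  have "act1 (gk (coroot (c k))) (u k) = exp t *\<^sub>\<complex> u k"
    using M.path_stateD(3)[OF path_state_u[OF k], of Pos 0] by (simp add: phi_Pos_0 psi_coeff_def)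
  moreover have "act2 (gk (coroot (c k))) v2 = (if c k = 0 then inverse (exp t) else 1) *\<^sub>\<complex> v2"
    using V2 ck qpow_of_int[of t 0] qpow_of_int[of t "-1"]
    by (simp add: is_V_lowest_def weight_vector_def pairing_coroot fund_weight_def power_int_minus)
  ultimately have "act (gk (coroot (c k))) (u k \<otimes> v2) =
      (if c k = 0 then 1 else exp t) *\<^sub>\<complex> (u k \<otimes> v2)"
    using tensor ck by (simp add: is_drinfeld_tensor_def tens_scale_left tens_scale_right)
  moreover have "act (gk (coroot (c k))) (u k \<otimes> v2) = exp t powi z *\<^sub>\<complex> (u k \<otimes> v2)"
    using \<mu>(2) ck by (simp add: weight_vector_def z qpow_of_int)
  ultimately have "exp t powi z *\<^sub>\<complex> (u k \<otimes> v2) = (if c k = 0 then 1 else exp t) *\<^sub>\<complex> (u k \<otimes> v2)"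
    by (rule trans[OF sym, rotated])
  then have "exp t powi z = (if c k = 0 then 1 else exp t)"
    using u_tensor_nonzero[OF k] unfolding cvec.scale_cancel_right by blast
  then have "exp t powi z = exp t powi (if c k = 0 then 0 else 1)" by simp
  then have "z = (if c k = 0 then 0 else 1)"
    using exp_powi_inj[OF q_not_root] by blast
  moreover have "c k = 0 \<longleftrightarrow> k = L"
    using path_L M.path_distinct[of k L] k by (cases "k = L") auto
  ultimately show ?thesis by (simp add: z)
qed

text \<open>As \<open>S\<^sub>i\<close> is a relation whose weight and sign are chosen existentially, the weight has to be
  pinned down first; being \<open>1\<close>, it leaves only a single application of \<open>x\<^sup>-\<close>.\<close>

lemma S_composite_path:
  "k \<le> L \<Longrightarrow> S_composite n t act (rev (map c [0..<k])) (v1 \<otimes> v2) w \<Longrightarrow> w = u k \<otimes> v2"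
proof (induction k arbitrary: w)
  case (Suc k)
  have k: "k < L" using Suc.prems by simp
  have "S_graph n t act (c k) (u k \<otimes> v2) w"
    using Suc by auto
  then obtain \<mu> \<epsilon> r where \<mu>: "i_extremal_of_weight n t act (c k) \<mu> (u k \<otimes> v2)"
    and r: "of_int (sg \<epsilon>) * pairing \<mu> (coroot (c k)) = of_nat r"
    and w: "w = (1 / qfact t r) *\<^sub>\<complex> act (gx (opp \<epsilon>) (c k) 0 ^ r) (u k \<otimes> v2)"
    by (auto simp: S_graph_def)
  have "pairing \<mu> (coroot (c k)) = 1"
    using \<mu> weight_u_tensor[of k \<mu>] k by (simp add: i_extremal_of_weight_def)
  then have "(of_int (sg \<epsilon>) :: rat) = of_nat r"
    using r by simp
  then have "\<epsilon> = Pos \<and> r = 1"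
    by (cases \<epsilon>) auto
  moreover have "qfact t 1 = 1"
    using M.q_minus_inverse_nonzero by (simp add: qfact_def qint_def)
  ultimately show ?case
    using w lower_tensor_interior[OF k] by simp
qed simp

text \<open>At the end of the path the vector has weight \<open>0\<close> for colour \<open>0\<close>, so extremality makes the
  regularized value in \<open>lower_tensor\<close> zero. The numerator of \<open>\<psi>(bqu / \<gamma>\<^sub>L)\<^sup>-\<^sup>1\<close> then vanishes at \<open>u = 1\<close>.\<close>

lemma extremal_imp_ratio:
  assumes "extremal n t act T (v1 \<otimes> v2)"
  shows "a * exp t ^ L = b"
proof -
  have "set (rev (map c [0..<L])) \<subseteq> {0..n}"
    using M.path_le by auto
  then obtain w where w: "S_composite n t act (rev (map c [0..<L])) (v1 \<otimes> v2) w"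
      "\<And>i. i \<le> n \<Longrightarrow> i_extremal n t act i w"
    using assms unfolding extremal_def by blast
  have "w = u L \<otimes> v2" using S_composite_path w(1) by simp
  then obtain \<mu> where \<mu>: "i_extremal_of_weight n t act (c L) \<mu> (u L \<otimes> v2)"
    using w(2)[of "c L"] M.path_le[of L] by (auto simp: i_extremal_def)
  then have "pairing \<mu> (coroot (c L)) = 0"
    using weight_u_tensor[of L \<mu>] by (simp add: i_extremal_of_weight_def)
  then have zero: "act (gx Neg (c L) 0) (u L \<otimes> v2) = 0"
    using \<mu> by (simp add: i_extremal_of_weight_def)
  define g where "g m = inverse (\<gamma> L ^ m) * fps_nth (inverse (psi_expansion t Pos (b * exp t))) m" for m
  have "poly [:1, - (b * exp t / \<gamma> L):] 1 = 0"
  proof (rule rational_value_eq_0)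
    show "rational_value_at_1 (\<lambda>k. (if k \<ge> 0 then g (nat k) else 0) *\<^sub>\<complex> (u (Suc L) \<otimes> v2)) 0"
      using lower_tensor[of L] path_L zero
      by (auto elim!: back_subst[where P = "\<lambda>F. rational_value_at_1 F _"] simp: fun_eq_iff g_def power_int_def power_inverse)
    show "u (Suc L) \<otimes> v2 \<noteq> 0"
      using M.lower_path_nonzero[OF path_state_u, of L] V_lowest_nonzero[OF V2] by (intro tens_nonzero) simp_all
    \<comment> \<open>The expansion of \<open>\<psi>(bqz)\<^sup>-\<^sup>1\<close> rescaled by \<open>z \<mapsto> z / \<gamma>\<^sub>L\<close>.\<close>
    show "Abs_fps g * fps_of_poly [:exp t, - (b / \<gamma> L):] = fps_of_poly [:1, - (b * exp t / \<gamma> L):]"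
    proof (rule fps_ext)
      fix m
      let ?h = "fps_nth (inverse (psi_expansion t Pos (b * exp t)))"
      have rec: "exp t * ?h m + (if m = 0 then 0 else - b * ?h (m - 1)) = coeff [:1, - (b * exp t):] m"
        using arg_cong[OF inverse_psi_mult_num[of t b], of "\<lambda>F. fps_nth F m"]
        unfolding fps_nth_mult_linear by (simp only: fps_of_poly_nth)
      have "fps_nth (Abs_fps g * fps_of_poly [:exp t, - (b / \<gamma> L):]) m =
          inverse (\<gamma> L ^ m) * (exp t * ?h m + (if m = 0 then 0 else - b * ?h (m - 1)))"
        by (cases m) (simp_all add: fps_nth_mult_linear g_def field_simps del: psi_expansion.simps)
      also have "\<dots> = coeff [:1, - (b * exp t / \<gamma> L):] m"
        unfolding rec
        by (cases m) (auto simp: coeff_pCons divide_inverse split: nat.splits)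
      finally show "fps_nth (Abs_fps g * fps_of_poly [:exp t, - (b / \<gamma> L):]) m =
          fps_nth (fps_of_poly [:1, - (b * exp t / \<gamma> L):]) m" by simp
    qed
  qed
  then show ?thesis
    by (simp add: \<gamma>_def field_simps)
qed

end


section \<open>The two arcs from \<open>\<ell>\<close> to \<open>0\<close>\<close>

text \<open>For \<open>l = n\<close> the first vertex would be adjacent to the last one across the edge between \<open>n\<close> and \<open>0\<close>. In the
  other direction the same happens for \<open>l = 1\<close>.\<close>

lemma induced_path_down:
  assumes "l < n"
  shows "induced_path n (\<lambda>k. l - k) l"
  unfolding induced_path_def cartan_matrix_def
  using assms by (intro conjI allI impI) (auto simp: adjacent_iff)

lemma induced_path_up:
  assumes "1 < l" "l \<le> n"
  shows "induced_path n (\<lambda>k. if l + k \<le> n then l + k else 0) (n + 1 - l)"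
  unfolding induced_path_def cartan_matrix_def
  using assms by (intro conjI allI impI) (auto simp: adjacent_iff)

theorem proposition3p6:
  fixes n l :: nat and t a b :: complex
    and act1 :: "free_alg \<Rightarrow> 'v::complex_vec \<Rightarrow> 'v" and v1 :: 'v
    and act2 :: "free_alg \<Rightarrow> 'w::complex_vec \<Rightarrow> 'w" and v2 :: 'w
    and act :: "free_alg \<Rightarrow> ('v, 'w) tensor \<Rightarrow> ('v, 'w) tensor"
    and T :: "('v, 'w) tensor set"
  assumes n: "n \<ge> 2"
    and q_not_root_of_unity: "\<forall>m::nat. m > 0 \<longrightarrow> exp t ^ m \<noteq> 1"
    and l: "l \<in> {1..n}"
    and a: "a \<noteq> 0" and b: "b \<noteq> 0"
    and ab: "a / b \<notin> {qpow t (- 2 - of_nat (min l (n + 1 - l)) - of_nat m) | m::nat. True}"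
    and V1: "is_V_highest n t l a act1 v1"
    and V2: "is_V_lowest n t b act2 v2"
    and tensor: "is_drinfeld_tensor n t act1 act2 act"
    and T: "T = generated_submodule n act (v1 \<otimes> v2)"
    and extremal: "extremal n t act T (v1 \<otimes> v2)"
  shows "a / b = qpow t (- of_nat (min l (n + 1 - l))) \<and>
    ((even n \<and> l \<in> {1, n}) \<or> (\<exists>r. n = 2 * r + 1 \<and> l \<in> {1, r + 1, n}))"
proof -
  have ratio: "a * exp t ^ L = b" if "induced_path n c L" "c 0 = l" "c L = 0" for c L
  proof -
    interpret extremal_tensor_along_path n l t a b act1 v1 act2 v2 act c L
      using assms that by unfold_locales auto
    show ?thesis by (rule extremal_imp_ratio[OF extremal])
  qed
  have down: "a * exp t ^ l = b" if "l < n"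
    using ratio[OF induced_path_down[OF that]] by simp
  have up: "a * exp t ^ (n + 1 - l) = b" if "1 < l"
    using ratio[OF induced_path_up[OF that]] l by simp
  have quotient: "a / b = qpow t (- of_nat d)" if "a * exp t ^ d = b" for d
  proof -
    have "qpow t (- of_nat d) = inverse (exp t ^ d)"
      using qpow_of_int[of t "- int d"] by (simp add: power_int_minus)
    then show ?thesis using that a by (auto simp: field_simps)
  qed
  have parity: "even n \<or> (\<exists>r. n = 2 * r + 1)"
    by (metis oddE)
  consider "l = 1" | "l = n" "1 < l" | "1 < l" "l < n"
    using l by force
  then show ?thesis
  proof cases
    case 1
    then have "min l (n + 1 - l) = l" using n by simp
    then have "a / b = qpow t (- of_nat (min l (n + 1 - l)))"
      using quotient[OF down] 1 n by simp
    then show ?thesis using parity 1 by auto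
  next
    case 2
    then have "min l (n + 1 - l) = n + 1 - l" by simp
    then have "a / b = qpow t (- of_nat (min l (n + 1 - l)))"
      using quotient[OF up] 2 by simp
    then show ?thesis using parity 2 by auto
  next
    case 3
    then have "exp t ^ l = exp t ^ (n + 1 - l)"
      using up down a by (metis mult_left_cancel)
    then have "exp t powi int l = exp t powi int (n + 1 - l)"
      unfolding power_int_of_nat .
    then have "int l = int (n + 1 - l)"
      using exp_powi_inj[of t] q_not_root_of_unity by blast
    then have l_eq: "l = n + 1 - l" by simp
    then have "min l (n + 1 - l) = l" by simp
    then have "a / b = qpow t (- of_nat (min l (n + 1 - l)))"
      using quotient[OF down] 3 by simp
    moreover have "n = 2 * (l - 1) + 1" "l = (l - 1) + 1"
      using l_eq 3 by auto
    ultimately show ?thesis by blast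
  qed
qed

end
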